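(* Let $\theta_k,\alpha_k,\gamma_k$ be real phases and $t_k,r_k$ real coefficients with $r_k^2+t_k^2=1$, $k\in\mathbb Z$. Let $U$ be the associated unitary operator on $\ell^2(\mathbb Z)$ and $U^+$ the associated unitary operator on $\ell^2(\mathbb N^* )$. If $\liminf_{k\to+\infty}t_k=0$ and $\liminf_{k\to-\infty}t_k=0$, then $$\sigma_{a.c.}(U)=\sigma_{a.c.}(U^+)=\emptyset .$$
   Context: Put $$S_k=e^{-i\theta_k}\begin{pmatrix} r_k e^{-i\alpha_k} & i t_k e^{i\gamma_k}\\ i t_k e^{-i\gamma_k} & r_k e^{i\alpha_k}\end{pmatrix},\qquad k\in\mathbb Z .$$ On $\ell^2(\mathbb Z)$ with canonical basis $(\varphi_k)_{k\in\mathbb Z}$: $U_e$ acts on each $\mathrm{span}\{\varphi_{2k},\varphi_{2k+1}\}$ by $S_{2k}$ in the ordered basis $(\varphi_{2k},\varphi_{2k+1})$, $U_o$ acts on each $\mathrm{span}\{\varphi_{2k+1},\varphi_{2k+2}\}$ by $S_{2k+1}$ in the ordered basis $(\varphi_{2k+1},\varphi_{2k+2})$, and $U=U_oU_e$. On $\ell^2(\mathbb N^* )$, $\mathbb N^*=\{1,2,\dots\}$: $U^+=U_o^+U_e^+$ with $U_e^+\varphi_1=e^{-i\theta_0}\varphi_1$, $U_e^+$ acting as $S_{2k}$ on $\mathrm{span}\{\varphi_{2k},\varphi_{2k+1}\}$ for $k\ge1$, and $U_o^+$ acting as $S_{2k+1}$ on $\mathrm{span}\{\varphi_{2k+1},\varphi_{2k+2}\}$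 for $k\ge0$. $\sigma_{a.c.}$ denotes the absolutely continuous spectrum. *)

theory Defs
  imports "HOL-Analysis.Analysis"
begin

section \<open>The Hilbert space of square-summable sequences\<close>

text \<open>Elements are functions on the whole index type that vanish outside the index set, so that
  the space of sequences indexed by the integers is \<open>ell2 UNIV\<close> and the one indexed by the
  positive integers is \<open>ell2 {1..}\<close>.\<close>

definition ell2 :: "'a set \<Rightarrow> ('a \<Rightarrow> complex) set" where
  "ell2 I = {\<psi>. (\<forall>x. x \<notin> I \<longrightarrow> \<psi> x = 0) \<and> (\<lambda>x. (cmod (\<psi> x))\<^sup>2) summable_on UNIV}"

definition ell2_inner :: "('a \<Rightarrow> complex) \<Rightarrow> ('a \<Rightarrow> complex) \<Rightarrow> complex" where
  "ell2_inner \<phi> \<psi> = (\<Sum>\<^sub>\<infinity>x. cnj (\<phi> x) * \<psi> x)"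

definition ell2_norm :: "('a \<Rightarrow> complex) \<Rightarrow> real" where
  "ell2_norm \<psi> = sqrt (\<Sum>\<^sub>\<infinity>x. (cmod (\<psi> x))\<^sup>2)"


section \<open>The absolutely continuous spectrum of a unitary operator\<close>

definition circle_lebesgue :: "complex measure" where
  "circle_lebesgue = distr (restrict_space lborel {0..<2*pi}) borel cis"

text \<open>The spectral measure of a vector \<open>\<psi>\<close> for a unitary operator \<open>T\<close> is the finite positive
  Borel measure \<open>\<mu>\<close> on the unit circle whose \<open>n\<close>-th moment is the inner product of \<open>\<psi>\<close> with
  \<open>T\<^sup>n \<psi>\<close>, for every integer \<open>n\<close>. Both sides are conjugated when \<open>n\<close> is replaced by \<open>-n\<close>, so only
  natural \<open>n\<close> are mentioned. By the spectral theorem (or Herglotz's theorem) there is exactly one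
  such measure.\<close>

definition is_spectral_measure ::
  "(('a \<Rightarrow> complex) \<Rightarrow> ('a \<Rightarrow> complex)) \<Rightarrow> ('a \<Rightarrow> complex) \<Rightarrow> complex measure \<Rightarrow> bool" where
  "is_spectral_measure T \<psi> \<mu> \<longleftrightarrow>
     finite_measure \<mu> \<and> sets \<mu> = sets borel \<and> emeasure \<mu> (- sphere 0 1) = 0 \<and>
     (\<forall>n. ell2_inner \<psi> ((T ^^ n) \<psi>) = (\<integral>z. z ^ n \<partial>\<mu>))"

definition ac_subspace ::
  "('a \<Rightarrow> complex) set \<Rightarrow> (('a \<Rightarrow> complex) \<Rightarrow> ('a \<Rightarrow> complex)) \<Rightarrow> ('a \<Rightarrow> complex) set" where
  "ac_subspace H T =
     {\<psi> \<in> H. \<exists>\<mu>. is_spectral_measure T \<psi> \<mu> \<and> absolutely_continuous circle_lebesgue \<mu>}"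

text \<open>The spectrum of the restriction of \<open>T\<close> to a closed invariant subspace \<open>V\<close>: a complex number
  is in the resolvent set if the shifted operator is a bijection of \<open>V\<close> with bounded inverse.\<close>

definition spectrum_on ::
  "('a \<Rightarrow> complex) set \<Rightarrow> (('a \<Rightarrow> complex) \<Rightarrow> ('a \<Rightarrow> complex)) \<Rightarrow> complex set" where
  "spectrum_on V T =
     {z. \<not> (bij_betw (\<lambda>\<psi> x. T \<psi> x - z * \<psi> x) V V \<and>
             (\<exists>C. \<forall>\<psi>\<in>V. ell2_norm \<psi> \<le> C * ell2_norm (\<lambda>x. T \<psi> x - z * \<psi> x)))}"

definition ac_spectrum ::
  "('a \<Rightarrow> complex) set \<Rightarrow> (('a \<Rightarrow> complex) \<Rightarrow> ('a \<Rightarrow> complex)) \<Rightarrow> complex set" where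
  "ac_spectrum H T = spectrum_on (ac_subspace H T) T"


section \<open>The operators\<close>

definition scattering_matrix ::
  "(int \<Rightarrow> real) \<Rightarrow> (int \<Rightarrow> real) \<Rightarrow> (int \<Rightarrow> real) \<Rightarrow> (int \<Rightarrow> real) \<Rightarrow> (int \<Rightarrow> real) \<Rightarrow>
   int \<Rightarrow> complex^2^2" where
  "scattering_matrix \<theta> \<alpha> \<gamma> r t k =
     vector [vector [cis (- \<theta> k) * (of_real (r k) * cis (- \<alpha> k)),
                     cis (- \<theta> k) * (\<i> * of_real (t k) * cis (\<gamma> k))],
             vector [cis (- \<theta> k) * (\<i> * of_real (t k) * cis (- \<gamma> k)),
                     cis (- \<theta> k) * (of_real (r k) * cis (\<alpha> k))]]"

text \<open>In terms of coordinates, an operator that acts on the span of the canonical basis vectors with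
  indices \<open>k\<close> and \<open>k + 1\<close> by the matrix \<open>S k\<close> sends \<open>\<psi>\<close> to the sequence with the following entries
  at \<open>k\<close> and at \<open>k + 1\<close>.\<close>

definition block_fst :: "(int \<Rightarrow> complex^2^2) \<Rightarrow> (int \<Rightarrow> complex) \<Rightarrow> int \<Rightarrow> complex" where
  "block_fst S \<psi> k = S k $ 1 $ 1 * \<psi> k + S k $ 1 $ 2 * \<psi> (k + 1)"

definition block_snd :: "(int \<Rightarrow> complex^2^2) \<Rightarrow> (int \<Rightarrow> complex) \<Rightarrow> int \<Rightarrow> complex" where
  "block_snd S \<psi> k = S k $ 2 $ 1 * \<psi> k + S k $ 2 $ 2 * \<psi> (k + 1)"

definition U_even :: "(int \<Rightarrow> complex^2^2) \<Rightarrow> (int \<Rightarrow> complex) \<Rightarrow> (int \<Rightarrow> complex)" where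
  "U_even S \<psi> = (\<lambda>j. if even j then block_fst S \<psi> j else block_snd S \<psi> (j - 1))"

definition U_odd :: "(int \<Rightarrow> complex^2^2) \<Rightarrow> (int \<Rightarrow> complex) \<Rightarrow> (int \<Rightarrow> complex)" where
  "U_odd S \<psi> = (\<lambda>j. if odd j then block_fst S \<psi> j else block_snd S \<psi> (j - 1))"

definition U_full ::
  "(int \<Rightarrow> real) \<Rightarrow> (int \<Rightarrow> real) \<Rightarrow> (int \<Rightarrow> real) \<Rightarrow> (int \<Rightarrow> real) \<Rightarrow> (int \<Rightarrow> real) \<Rightarrow>
   (int \<Rightarrow> complex) \<Rightarrow> (int \<Rightarrow> complex)" where
  "U_full \<theta> \<alpha> \<gamma> r t =
     U_odd (scattering_matrix \<theta> \<alpha> \<gamma> r t) \<circ> U_even (scattering_matrix \<theta> \<alpha> \<gamma> r t)"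

definition U_even_plus ::
  "real \<Rightarrow> (int \<Rightarrow> complex^2^2) \<Rightarrow> (int \<Rightarrow> complex) \<Rightarrow> (int \<Rightarrow> complex)" where
  "U_even_plus \<theta>\<^sub>0 S \<psi> =
     (\<lambda>j. if j < 1 then 0
          else if j = 1 then cis (- \<theta>\<^sub>0) * \<psi> 1
          else if even j then block_fst S \<psi> j
          else block_snd S \<psi> (j - 1))"

definition U_odd_plus :: "(int \<Rightarrow> complex^2^2) \<Rightarrow> (int \<Rightarrow> complex) \<Rightarrow> (int \<Rightarrow> complex)" where
  "U_odd_plus S \<psi> =
     (\<lambda>j. if j < 1 then 0
          else if odd j then block_fst S \<psi> j
          else block_snd S \<psi> (j - 1))"

definition U_plus ::
  "(int \<Rightarrow> real) \<Rightarrow> (int \<Rightarrow> real) \<Rightarrow> (int \<Rightarrow> real) \<Rightarrow> (int \<Rightarrow> real) \<Rightarrow> (int \<Rightarrow> real) \<Rightarrow>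
   (int \<Rightarrow> complex) \<Rightarrow> (int \<Rightarrow> complex)" where
  "U_plus \<theta> \<alpha> \<gamma> r t =
     U_odd_plus (scattering_matrix \<theta> \<alpha> \<gamma> r t) \<circ>
     U_even_plus (\<theta> 0) (scattering_matrix \<theta> \<alpha> \<gamma> r t)"

end

theory Submission
  imports Defs
begin

text \<open>The mass that one time step moves across the bond between \<open>k\<close> and \<open>k + 1\<close> is at most \<open>2 |t\<^sub>k|\<close>
  times the mass near \<open>k\<close>. If the spectral density of \<open>\<psi>\<close> is bounded, then the mass of \<open>U\<^sup>n\<psi>\<close> at a
  fixed site is summable over \<open>n\<close>, with a bound \<open>B\<close> that does not depend on the site. Hence, on the
  one hand, the mass of \<open>U\<^sup>n\<psi>\<close> in a finite interval tends to zero on average; on the other hand, the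
  total mass that ever crosses the ends \<open>a\<close> and \<open>b\<close> of the interval is \<open>O(B (|t\<^sub>a| + |t\<^sub>b|))\<close>. So the
  initial mass in the interval is of this order, and it vanishes as \<open>a\<close> and \<open>b\<close> run through
  sequences along which \<open>t\<close> tends to zero. A vector with an unbounded spectral density is first
  replaced by \<open>h(U)\<psi>\<close>, where the trigonometric polynomial \<open>h\<close> approximates the indicator function of
  a sublevel set of the density.\<close>

section \<open>Square-summable sequences\<close>

lemma cmod_add_square_le: "(cmod (a + b))\<^sup>2 \<le> 2 * (cmod a)\<^sup>2 + 2 * (cmod b)\<^sup>2"
proof -
  have "(cmod (a + b))\<^sup>2 \<le> (cmod a + cmod b)\<^sup>2"
    by (simp add: norm_triangle_ineq power_mono)
  also have "\<dots> \<le> 2 * (cmod a)\<^sup>2 + 2 * (cmod b)\<^sup>2"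
    using zero_le_power2[of "cmod a - cmod b"] by (simp add: power2_eq_square algebra_simps)
  finally show ?thesis .
qed

lemma ell2_lincomb:
  assumes "\<phi> \<in> ell2 I" "\<psi> \<in> ell2 I"
  shows "(\<lambda>x. a * \<phi> x + b * \<psi> x) \<in> ell2 I"
proof -
  have "(\<lambda>x. 2 * (cmod a)\<^sup>2 * (cmod (\<phi> x))\<^sup>2 + 2 * (cmod b)\<^sup>2 * (cmod (\<psi> x))\<^sup>2) summable_on UNIV"
    using assms by (intro summable_on_add summable_on_cmult_right) (auto simp: ell2_def)
  then have "(\<lambda>x. (cmod (a * \<phi> x + b * \<psi> x))\<^sup>2) summable_on UNIV"
    by (rule summable_on_comparison_test)
       (use cmod_add_square_le[of "a * \<phi> x" "b * \<psi> x" for x] in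
         \<open>auto simp: norm_mult power_mult_distrib mult.assoc\<close>)
  then show ?thesis using assms by (auto simp: ell2_def)
qed

lemma ell2_inner_summable:
  assumes "\<phi> \<in> ell2 I" "\<psi> \<in> ell2 I"
  shows "(\<lambda>x. cnj (\<phi> x) * \<psi> x) summable_on UNIV"
proof (rule abs_summable_summable)
  have "(\<lambda>x. (cmod (\<phi> x))\<^sup>2 + (cmod (\<psi> x))\<^sup>2) summable_on UNIV"
    using assms by (intro summable_on_add) (auto simp: ell2_def)
  then show "(\<lambda>x. norm (cnj (\<phi> x) * \<psi> x)) summable_on UNIV"
  proof (rule summable_on_comparison_test)
    fix x
    have "2 * (cmod (\<phi> x) * cmod (\<psi> x)) \<le> (cmod (\<phi> x))\<^sup>2 + (cmod (\<psi> x))\<^sup>2"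
      using zero_le_power2[of "cmod (\<phi> x) - cmod (\<psi> x)"]
      by (simp add: power2_eq_square algebra_simps)
    moreover have "0 \<le> cmod (\<phi> x) * cmod (\<psi> x)" by simp
    ultimately have "cmod (\<phi> x) * cmod (\<psi> x) \<le> (cmod (\<phi> x))\<^sup>2 + (cmod (\<psi> x))\<^sup>2"
      by linarith
    then show "norm (cnj (\<phi> x) * \<psi> x) \<le> (cmod (\<phi> x))\<^sup>2 + (cmod (\<psi> x))\<^sup>2"
      by (simp add: norm_mult)
  qed auto
qed

lemma ell2_inner_commute: "ell2_inner \<psi> \<phi> = cnj (ell2_inner \<phi> \<psi>)"
  unfolding ell2_inner_def by (subst infsum_cnj[symmetric]) (simp add: mult.commute)

lemma ell2_inner_lincomb_right:
  assumes "\<zeta> \<in> ell2 I" "\<phi> \<in> ell2 I" "\<psi> \<in> ell2 I"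
  shows "ell2_inner \<zeta> (\<lambda>x. a * \<phi> x + b * \<psi> x) = a * ell2_inner \<zeta> \<phi> + b * ell2_inner \<zeta> \<psi>"
proof -
  have "ell2_inner \<zeta> (\<lambda>x. a * \<phi> x + b * \<psi> x)
      = (\<Sum>\<^sub>\<infinity>x. a * (cnj (\<zeta> x) * \<phi> x) + b * (cnj (\<zeta> x) * \<psi> x))"
    unfolding ell2_inner_def by (simp add: algebra_simps)
  also have "\<dots> = (\<Sum>\<^sub>\<infinity>x. a * (cnj (\<zeta> x) * \<phi> x)) + (\<Sum>\<^sub>\<infinity>x. b * (cnj (\<zeta> x) * \<psi> x))"
    using assms by (intro infsum_add summable_on_cmult_right ell2_inner_summable)
  finally show ?thesis by (simp add: ell2_inner_def infsum_cmult_right')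
qed

text \<open>Finite partial sums are the form in which norm bounds reach the individual
  sites.\<close>

lemma ell2_sum_square_le_inner:
  assumes "\<psi> \<in> ell2 I" "finite F"
  shows "(\<Sum>x\<in>F. (cmod (\<psi> x))\<^sup>2) \<le> Re (ell2_inner \<psi> \<psi>)"
proof -
  have "ell2_inner \<psi> \<psi> = (\<Sum>\<^sub>\<infinity>x. complex_of_real ((cmod (\<psi> x))\<^sup>2))"
    by (simp add: ell2_inner_def complex_norm_square mult.commute del: of_real_power)
  also have "\<dots> = complex_of_real (\<Sum>\<^sub>\<infinity>x. (cmod (\<psi> x))\<^sup>2)"
    using assms by (intro infsumI has_sum_of_real has_sum_infsum) (auto simp: ell2_def)
  finally have "Re (ell2_inner \<psi> \<psi>) = (\<Sum>\<^sub>\<infinity>x. (cmod (\<psi> x))\<^sup>2)" by simp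
  then show ?thesis
    using assms finite_sum_le_infsum[of "\<lambda>x. (cmod (\<psi> x))\<^sup>2" UNIV F] by (auto simp: ell2_def)
qed

section \<open>Layers of unitary blocks\<close>

definition matrix_adjoint :: "complex^2^2 \<Rightarrow> complex^2^2" where
  "matrix_adjoint A = (\<chi> i j. cnj (A $ j $ i))"

definition unitary_blocks :: "(int \<Rightarrow> complex^2^2) \<Rightarrow> bool" where
  "unitary_blocks S \<longleftrightarrow>
     (\<forall>k. S k ** matrix_adjoint (S k) = mat 1 \<and> matrix_adjoint (S k) ** S k = mat 1)"

definition adjoint_blocks :: "(int \<Rightarrow> complex^2^2) \<Rightarrow> int \<Rightarrow> complex^2^2" where
  "adjoint_blocks S k = matrix_adjoint (S k)"

text \<open>The predicate \<open>Q\<close> marks the left sites of the blocks. With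
  \<open>even\<close> and \<open>odd\<close> it yields the two factors of the operator, so each
  property is proved once for both.\<close>

definition layer ::
  "(int \<Rightarrow> bool) \<Rightarrow> (int \<Rightarrow> complex^2^2) \<Rightarrow> (int \<Rightarrow> complex) \<Rightarrow> (int \<Rightarrow> complex)" where
  "layer Q S \<psi> = (\<lambda>j. if Q j then block_fst S \<psi> j else block_snd S \<psi> (j - 1))"

lemma U_even_eq_layer: "U_even S = layer even S"
  and U_odd_eq_layer: "U_odd S = layer odd S"
  by (auto simp: fun_eq_iff U_even_def U_odd_def layer_def)

lemma unitary_blocks_columns:
  assumes "unitary_blocks S"
  shows "cnj (S k $ 1 $ 1) * S k $ 1 $ 1 + cnj (S k $ 2 $ 1) * S k $ 2 $ 1 = 1"
    "cnj (S k $ 1 $ 2) * S k $ 1 $ 2 + cnj (S k $ 2 $ 2) * S k $ 2 $ 2 = 1"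
    "cnj (S k $ 1 $ 1) * S k $ 1 $ 2 + cnj (S k $ 2 $ 1) * S k $ 2 $ 2 = 0"
    "cnj (S k $ 1 $ 2) * S k $ 1 $ 1 + cnj (S k $ 2 $ 2) * S k $ 2 $ 1 = 0"
  using assms unfolding unitary_blocks_def
  by (auto simp: vec_eq_iff matrix_matrix_mult_def matrix_adjoint_def mat_def forall_2 sum_2)

lemma unitary_blocks_rows:
  assumes "unitary_blocks S"
  shows "S k $ 1 $ 1 * cnj (S k $ 1 $ 1) + S k $ 1 $ 2 * cnj (S k $ 1 $ 2) = 1"
    "S k $ 2 $ 1 * cnj (S k $ 2 $ 1) + S k $ 2 $ 2 * cnj (S k $ 2 $ 2) = 1"
    "S k $ 1 $ 1 * cnj (S k $ 2 $ 1) + S k $ 1 $ 2 * cnj (S k $ 2 $ 2) = 0"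
    "S k $ 2 $ 1 * cnj (S k $ 1 $ 1) + S k $ 2 $ 2 * cnj (S k $ 1 $ 2) = 0"
  using assms unfolding unitary_blocks_def
  by (auto simp: vec_eq_iff matrix_matrix_mult_def matrix_adjoint_def mat_def forall_2 sum_2)

lemma unitary_blocks_adjoint: "unitary_blocks S \<Longrightarrow> unitary_blocks (adjoint_blocks S)"
  by (auto simp: unitary_blocks_def adjoint_blocks_def matrix_adjoint_def)

lemma unitary_scattering_matrix:
  assumes "\<And>k. (r k)\<^sup>2 + (t k)\<^sup>2 = 1"
  shows "unitary_blocks (scattering_matrix \<theta> \<alpha> \<gamma> r t)"
  unfolding unitary_blocks_def
proof (intro allI)
  fix k
  \<comment> \<open>The phases and their inverses become free symbols, so each matrix entry is a
    polynomial identity that follows from \<open>phase\<close>, \<open>rt\<close> and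
    \<open>ii\<close>.\<close>
  define u U a A g G R T i where "u = cis (- \<theta> k)" and "U = cis (\<theta> k)"
    and "a = cis (- \<alpha> k)" and "A = cis (\<alpha> k)" and "g = cis (\<gamma> k)" and "G = cis (- \<gamma> k)"
    and "R = complex_of_real (r k)" and "T = complex_of_real (t k)" and "i = \<i>"
  have phase: "u * U = 1" "a * A = 1" "g * G = 1"
    by (simp_all add: u_def U_def a_def A_def g_def G_def cis_mult)
  have rt: "R * R + T * T = 1"
    unfolding R_def T_def using assms[of k] by (metis of_real_1 of_real_add of_real_mult power2_eq_square)
  have ii: "i * i = - 1" by (simp add: i_def)
  have cnjs: "cnj u = U" "cnj a = A" "cnj A = a" "cnj g = G" "cnj G = g" "cnj R = R" "cnj T = T" "cnj i = - i"
    by (simp_all add: u_def U_def a_def A_def g_def G_def cis_cnj R_def T_def i_def)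
  have S: "scattering_matrix \<theta> \<alpha> \<gamma> r t k =
     vector [vector [u * (R * a), u * (i * T * g)], vector [u * (i * T * G), u * (R * A)]]"
    by (simp add: scattering_matrix_def u_def a_def A_def g_def G_def R_def T_def i_def)
  show "scattering_matrix \<theta> \<alpha> \<gamma> r t k ** matrix_adjoint (scattering_matrix \<theta> \<alpha> \<gamma> r t k) = mat 1 \<and> matrix_adjoint (scattering_matrix \<theta> \<alpha> \<gamma> r t k) ** scattering_matrix \<theta> \<alpha> \<gamma> r t k = mat 1"
    unfolding S
    by (simp add: vec_eq_iff forall_2 matrix_matrix_mult_def matrix_adjoint_def mat_def sum_2 cnjs)
       (intro conjI; use phase rt ii in algebra)
qed

text \<open>The rows of a unitary block are orthonormal. This right inverse supplies the backward
  half of the orbit.\<close>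

lemma layer_adjoint_layer:
  assumes S: "unitary_blocks S" and Q: "\<And>j. Q (j + 1) \<longleftrightarrow> \<not> Q j"
  shows "layer Q S (layer Q (adjoint_blocks S) \<psi>) = \<psi>"
proof
  fix j
  have Q': "Q (j - 1) \<longleftrightarrow> \<not> Q j" using Q[of "j - 1"] by simp
  have e1: "a * (x * p + y * q) + b * (z * p + w * q) = (a * x + b * z) * p + (a * y + b * w) * q"
    for a b x y z w p q :: complex by (simp add: algebra_simps)
  show "layer Q S (layer Q (adjoint_blocks S) \<psi>) j = \<psi> j"
    using unitary_blocks_rows[OF S, of j] unitary_blocks_rows[OF S, of "j - 1"]
    by (simp add: layer_def block_fst_def block_snd_def Q Q' adjoint_blocks_def matrix_adjoint_def e1)
qed

text \<open>Once terms are collected by products of values of \<open>\<phi>\<close> and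
  \<open>\<psi>\<close>, the coefficients are inner products of columns of the block.\<close>

lemma block_inner:
  assumes "unitary_blocks S"
  shows "cnj (block_fst S \<phi> k) * block_fst S \<psi> k + cnj (block_snd S \<phi> k) * block_snd S \<psi> k
    = cnj (\<phi> k) * \<psi> k + cnj (\<phi> (k + 1)) * \<psi> (k + 1)"
proof -
  have "cnj (block_fst S \<phi> k) * block_fst S \<psi> k + cnj (block_snd S \<phi> k) * block_snd S \<psi> k =
     (cnj (S k $ 1 $ 1) * S k $ 1 $ 1 + cnj (S k $ 2 $ 1) * S k $ 2 $ 1) * (cnj (\<phi> k) * \<psi> k)
   + (cnj (S k $ 1 $ 2) * S k $ 1 $ 2 + cnj (S k $ 2 $ 2) * S k $ 2 $ 2) * (cnj (\<phi> (k+1)) * \<psi> (k+1))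
   + (cnj (S k $ 1 $ 1) * S k $ 1 $ 2 + cnj (S k $ 2 $ 1) * S k $ 2 $ 2) * (cnj (\<phi> k) * \<psi> (k+1))
   + (cnj (S k $ 1 $ 2) * S k $ 1 $ 1 + cnj (S k $ 2 $ 2) * S k $ 2 $ 1) * (cnj (\<phi> (k+1)) * \<psi> k)"
    by (simp add: block_fst_def block_snd_def algebra_simps)
  then show ?thesis by (simp add: unitary_blocks_columns[OF assms])
qed

lemma block_norm:
  assumes "unitary_blocks S"
  shows "(cmod (block_fst S \<psi> k))\<^sup>2 + (cmod (block_snd S \<psi> k))\<^sup>2
    = (cmod (\<psi> k))\<^sup>2 + (cmod (\<psi> (k + 1)))\<^sup>2"
proof -
  have "complex_of_real ((cmod (block_fst S \<psi> k))\<^sup>2 + (cmod (block_snd S \<psi> k))\<^sup>2)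
      = complex_of_real ((cmod (\<psi> k))\<^sup>2 + (cmod (\<psi> (k + 1)))\<^sup>2)"
    using block_inner[OF assms, of \<psi> k \<psi>]
    by (simp only: of_real_add complex_norm_square mult.commute)
  then show ?thesis using of_real_eq_iff by blast
qed

text \<open>The block containing \<open>j\<close> is \<open>{j, j + 1}\<close> or
  \<open>{j - 1, j}\<close>. Allowing all three sites gives a bound that does not depend on
  \<open>Q\<close>.\<close>

lemma layer_square_le:
  assumes S: "unitary_blocks S"
  shows "(cmod (layer Q S \<psi> j))\<^sup>2
    \<le> (cmod (\<psi> (j - 1)))\<^sup>2 + (cmod (\<psi> j))\<^sup>2 + (cmod (\<psi> (j + 1)))\<^sup>2"
proof -
  have "(cmod (block_fst S \<psi> j))\<^sup>2 \<le> (cmod (\<psi> j))\<^sup>2 + (cmod (\<psi> (j + 1)))\<^sup>2"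
    using block_norm[OF S, of \<psi> j] zero_le_power2[of "cmod (block_snd S \<psi> j)"] by linarith
  moreover have "(cmod (block_snd S \<psi> (j - 1)))\<^sup>2 \<le> (cmod (\<psi> (j - 1)))\<^sup>2 + (cmod (\<psi> j))\<^sup>2"
    using block_norm[OF S, of \<psi> "j - 1"] zero_le_power2[of "cmod (block_fst S \<psi> (j - 1))"]
    by (simp only: diff_add_cancel)
  ultimately show ?thesis
    using zero_le_power2[of "cmod (\<psi> (j - 1))"] zero_le_power2[of "cmod (\<psi> (j + 1))"]
    unfolding layer_def by (cases "Q j") (simp_all only: if_True if_False)
qed

lemma summable_on_shift_int:
  fixes f :: "int \<Rightarrow> 'b::{comm_monoid_add,topological_space}"
  shows "(\<lambda>j. f (j + c)) summable_on UNIV \<longleftrightarrow> f summable_on UNIV"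
proof -
  have "bij_betw (\<lambda>j::int. j + c) UNIV UNIV"
    by (rule bij_betwI[where g = "\<lambda>j. j - c"]) auto
  then show ?thesis by (rule summable_on_reindex_bij_betw)
qed

lemma layer_ell2:
  assumes S: "unitary_blocks S" and psi: "\<psi> \<in> ell2 UNIV"
  shows "layer Q S \<psi> \<in> ell2 UNIV"
proof -
  have s: "(\<lambda>j. (cmod (\<psi> (j + c)))\<^sup>2) summable_on UNIV" for c
    using psi summable_on_shift_int[of "\<lambda>j. (cmod (\<psi> j))\<^sup>2" c] by (simp add: ell2_def)
  have "(\<lambda>j. (cmod (\<psi> (j - 1)))\<^sup>2 + (cmod (\<psi> j))\<^sup>2 + (cmod (\<psi> (j + 1)))\<^sup>2) summable_on UNIV"
    using s[of "-1"] s[of 0] s[of 1] by (intro summable_on_add) auto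
  then have "(\<lambda>j. (cmod (layer Q S \<psi> j))\<^sup>2) summable_on UNIV"
    by (rule summable_on_comparison_test) (auto intro: layer_square_le[OF S])
  then show ?thesis by (simp add: ell2_def)
qed

text \<open>For an alternating \<open>Q\<close>, the set \<open>Collect Q\<close> and its shift by
  one partition the integers; the sum is thereby grouped into blocks.\<close>

lemma infsum_pairs_int:
  fixes f :: "int \<Rightarrow> complex"
  assumes f: "f summable_on UNIV" and Q: "\<And>j. Q (j + 1) \<longleftrightarrow> \<not> Q j"
  shows "infsum f UNIV = (\<Sum>\<^sub>\<infinity>j\<in>Collect Q. f j + f (j + 1))"
proof -
  have Q': "Q (j - 1) \<longleftrightarrow> \<not> Q j" for j using Q[of "j - 1"] by simp
  have b: "bij_betw (\<lambda>j. j + 1) (Collect Q) (- Collect Q)"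
    by (rule bij_betwI[where g = "\<lambda>j. j - 1"]) (auto simp: Q Q')
  have s: "f summable_on A" for A
    using f by (rule summable_on_subset_banach) auto
  have "infsum f UNIV = infsum f (Collect Q) + infsum f (- Collect Q)"
    using infsum_Un_disjoint[OF s s, of "Collect Q" "- Collect Q"] by simp
  also have "infsum f (- Collect Q) = (\<Sum>\<^sub>\<infinity>j\<in>Collect Q. f (j + 1))"
    using infsum_reindex_bij_betw[OF b, of f] by simp
  also have "infsum f (Collect Q) + \<dots> = (\<Sum>\<^sub>\<infinity>j\<in>Collect Q. f j + f (j + 1))"
    using summable_on_reindex_bij_betw[OF b, of f] s by (intro infsum_add[symmetric]) auto
  finally show ?thesis .
qed

lemma layer_inner:
  assumes S: "unitary_blocks S" and Q: "\<And>j. Q (j + 1) \<longleftrightarrow> \<not> Q j"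
    and "\<phi> \<in> ell2 UNIV" "\<psi> \<in> ell2 UNIV"
  shows "ell2_inner (layer Q S \<phi>) (layer Q S \<psi>) = ell2_inner \<phi> \<psi>"
proof -
  have "ell2_inner (layer Q S \<phi>) (layer Q S \<psi>) = (\<Sum>\<^sub>\<infinity>j\<in>Collect Q.
      cnj (layer Q S \<phi> j) * layer Q S \<psi> j + cnj (layer Q S \<phi> (j + 1)) * layer Q S \<psi> (j + 1))"
    unfolding ell2_inner_def
    using assms by (intro infsum_pairs_int ell2_inner_summable[of _ UNIV] layer_ell2)
  also have "\<dots> = (\<Sum>\<^sub>\<infinity>j\<in>Collect Q. cnj (\<phi> j) * \<psi> j + cnj (\<phi> (j + 1)) * \<psi> (j + 1))"
    by (intro infsum_cong) (simp add: layer_def Q block_inner[OF S])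
  also have "\<dots> = ell2_inner \<phi> \<psi>"
    unfolding ell2_inner_def
    using assms by (intro infsum_pairs_int[symmetric] ell2_inner_summable[of _ UNIV])
  finally show ?thesis .
qed

lemma layer_lincomb:
  "layer Q S (\<lambda>x. a * \<phi> x + b * \<psi> x) = (\<lambda>x. a * layer Q S \<phi> x + b * layer Q S \<psi> x)"
  by (auto simp: fun_eq_iff layer_def block_fst_def block_snd_def algebra_simps)

section \<open>Transport of mass by one layer\<close>

lemma unitary_blocks_entry:
  assumes "unitary_blocks S"
  shows "(cmod (S k $ 1 $ 1))\<^sup>2 + (cmod (S k $ 1 $ 2))\<^sup>2 = 1"
proof -
  have "complex_of_real ((cmod (S k $ 1 $ 1))\<^sup>2 + (cmod (S k $ 1 $ 2))\<^sup>2) = complex_of_real 1"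
    using unitary_blocks_rows(1)[OF assms, of k]
    by (simp only: of_real_add complex_norm_square mult.commute of_real_1)
  then show ?thesis using of_real_eq_iff by blast
qed

text \<open>The new modulus \<open>x\<close> lies between
  \<open>\<bar>\<rho> * p - \<tau> * q\<bar>\<close> and \<open>\<rho> * p + \<tau> * q\<close>.
  Since \<open>\<rho>\<^sup>2 = 1 - \<tau>\<^sup>2\<close>, the term \<open>p\<^sup>2\<close>
  cancels and every remaining term carries a factor \<open>\<tau>\<close>; squares of
  \<open>\<tau>\<close> are absorbed by \<open>\<tau> \<le> 1\<close>.\<close>

lemma block_fst_flux:
  assumes S: "unitary_blocks S"
  shows "\<bar>(cmod (block_fst S \<psi> k))\<^sup>2 - (cmod (\<psi> k))\<^sup>2\<bar>
    \<le> 2 * cmod (S k $ 1 $ 2) * ((cmod (\<psi> k))\<^sup>2 + (cmod (\<psi> (k + 1)))\<^sup>2)"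
proof -
  define \<rho> \<tau> p q where "\<rho> = cmod (S k $ 1 $ 1)" and "\<tau> = cmod (S k $ 1 $ 2)"
    and "p = cmod (\<psi> k)" and "q = cmod (\<psi> (k + 1))"
  have nn: "\<rho> \<ge> 0" "\<tau> \<ge> 0" "p \<ge> 0" "q \<ge> 0" by (auto simp: \<rho>_def \<tau>_def p_def q_def)
  have rt: "\<rho>\<^sup>2 + \<tau>\<^sup>2 = 1"
    using unitary_blocks_entry[OF S] by (simp add: \<rho>_def \<tau>_def)
  have r1: "\<rho> \<le> 1" using rt zero_le_power2[of \<tau>] by (intro power2_le_imp_le[of \<rho> 1]) (simp_all only: one_power2 zero_le_one)
  have t1: "\<tau> \<le> 1" using rt zero_le_power2[of \<rho>] by (intro power2_le_imp_le[of \<tau> 1]) (simp_all only: one_power2 zero_le_one)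
  define x where "x = cmod (block_fst S \<psi> k)"
  have up: "x \<le> \<rho> * p + \<tau> * q"
    unfolding x_def block_fst_def \<rho>_def \<tau>_def p_def q_def
    by (metis norm_mult norm_triangle_ineq)
  have lo: "\<bar>\<rho> * p - \<tau> * q\<bar> \<le> x"
    unfolding x_def block_fst_def \<rho>_def \<tau>_def p_def q_def
    using norm_triangle_ineq3[of "S k $ 1 $ 1 * \<psi> k" "- (S k $ 1 $ 2 * \<psi> (k + 1))"]
    by (simp add: norm_mult)
  have rp: "\<rho>\<^sup>2 * p\<^sup>2 = p\<^sup>2 - \<tau>\<^sup>2 * p\<^sup>2"
    using rt by (metis add_diff_cancel_right' left_diff_distrib mult_1)
  have x_le: "x\<^sup>2 \<le> p\<^sup>2 - \<tau>\<^sup>2 * p\<^sup>2 + \<tau>\<^sup>2 * q\<^sup>2 + 2 * (\<rho> * \<tau> * p * q)"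
  proof -
    have "x\<^sup>2 \<le> (\<rho> * p + \<tau> * q)\<^sup>2"
      using up by (intro power_mono) (auto simp: x_def)
    also have "\<dots> = \<rho>\<^sup>2 * p\<^sup>2 + \<tau>\<^sup>2 * q\<^sup>2 + 2 * (\<rho> * \<tau> * p * q)"
      by (simp add: power2_eq_square algebra_simps)
    finally show ?thesis by (simp add: rp)
  qed
  have x_ge: "p\<^sup>2 - \<tau>\<^sup>2 * p\<^sup>2 + \<tau>\<^sup>2 * q\<^sup>2 - 2 * (\<rho> * \<tau> * p * q) \<le> x\<^sup>2"
  proof -
    have "(\<rho> * p - \<tau> * q)\<^sup>2 = \<rho>\<^sup>2 * p\<^sup>2 + \<tau>\<^sup>2 * q\<^sup>2 - 2 * (\<rho> * \<tau> * p * q)"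
      by (simp add: power2_eq_square algebra_simps)
    moreover have "(\<rho> * p - \<tau> * q)\<^sup>2 \<le> x\<^sup>2"
      using lo by (metis abs_ge_zero power2_abs power_mono)
    ultimately show ?thesis by (simp add: rp)
  qed
  have tq: "\<tau>\<^sup>2 * q\<^sup>2 \<le> \<tau> * q\<^sup>2" and tp: "\<tau>\<^sup>2 * p\<^sup>2 \<le> \<tau> * p\<^sup>2"
    using t1 nn by (auto intro!: mult_right_mono simp: power2_eq_square mult_left_le)
  have cross: "2 * (\<rho> * \<tau> * p * q) \<le> \<tau> * p\<^sup>2 + \<tau> * q\<^sup>2"
  proof -
    have "2 * (p * q) \<le> p\<^sup>2 + q\<^sup>2"
      using zero_le_power2[of "p - q"] by (simp add: power2_eq_square algebra_simps)
    then have "\<tau> * (2 * (p * q)) \<le> \<tau> * (p\<^sup>2 + q\<^sup>2)" using nn by (intro mult_left_mono) auto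
    moreover have "\<rho> * (\<tau> * (2 * (p * q))) \<le> 1 * (\<tau> * (2 * (p * q)))"
      using r1 nn by (intro mult_right_mono) auto
    ultimately show ?thesis by (simp add: algebra_simps)
  qed
  have "0 \<le> \<tau>\<^sup>2 * q\<^sup>2" "0 \<le> \<tau>\<^sup>2 * p\<^sup>2" by auto
  with x_le x_ge tq tp cross have "\<bar>x\<^sup>2 - p\<^sup>2\<bar> \<le> 2 * (\<tau> * p\<^sup>2) + 2 * (\<tau> * q\<^sup>2)"
    unfolding abs_le_iff by (intro conjI) linarith+
  then have "\<bar>x\<^sup>2 - p\<^sup>2\<bar> \<le> 2 * \<tau> * (p\<^sup>2 + q\<^sup>2)" by (simp add: algebra_simps)
  then show ?thesis by (simp add: x_def \<tau>_def p_def q_def)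
qed

text \<open>Blocks inside the interval conserve mass, so only a block joining \<open>a\<close> to
  \<open>a + 1\<close> or \<open>b\<close> to \<open>b + 1\<close> can change the total. Both bonds
  are charged, whichever of them the layer uses.\<close>

lemma layer_mass_loss:
  assumes S: "unitary_blocks S" and Q: "\<And>j. Q (j + 1) \<longleftrightarrow> \<not> Q j" and "a \<le> b"
  shows "(\<Sum>j\<in>{a<..b}. (cmod (\<psi> j))\<^sup>2) \<le> (\<Sum>j\<in>{a<..b}. (cmod (layer Q S \<psi> j))\<^sup>2)
    + 2 * cmod (S a $ 1 $ 2) * ((cmod (\<psi> a))\<^sup>2 + (cmod (\<psi> (a + 1)))\<^sup>2)
    + 2 * cmod (S b $ 1 $ 2) * ((cmod (\<psi> b))\<^sup>2 + (cmod (\<psi> (b + 1)))\<^sup>2)"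
proof -
  define d where "d j = (cmod (layer Q S \<psi> j))\<^sup>2 - (cmod (\<psi> j))\<^sup>2" for j
  have pair: "d (j + 1) = - d j" if "Q j" for j
    using block_norm[OF S, of \<psi> j] that by (simp add: d_def layer_def Q)
  \<comment> \<open>Changes cancel within whole blocks. A block cut at the right end leaves
    \<open>d b\<close>; one cut at the left end has only \<open>a + 1\<close> inside, where the
    change is \<open>- d a\<close>.\<close>
  have "(\<Sum>j\<in>{a<..b}. d j) = (if Q b then d b else 0) - (if Q a then d a else 0)"
    using \<open>a \<le> b\<close>
  proof (induction b rule: int_ge_induct)
    case (step i)
    have "{a<..i + 1} = insert (i + 1) {a<..i}" using step.hyps by auto
    then show ?case using step.IH by (auto simp: Q pair)
  qed simp
  moreover have "\<bar>d j\<bar> \<le> 2 * cmod (S j $ 1 $ 2) * ((cmod (\<psi> j))\<^sup>2 + (cmod (\<psi> (j + 1)))\<^sup>2)"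
    if "Q j" for j
    using block_fst_flux[OF S, of \<psi> j] that by (simp add: d_def layer_def)
  moreover have "0 \<le> 2 * cmod (S j $ 1 $ 2) * ((cmod (\<psi> j))\<^sup>2 + (cmod (\<psi> (j + 1)))\<^sup>2)" for j
    by simp
  ultimately have "- (2 * cmod (S a $ 1 $ 2) * ((cmod (\<psi> a))\<^sup>2 + (cmod (\<psi> (a + 1)))\<^sup>2)
    + 2 * cmod (S b $ 1 $ 2) * ((cmod (\<psi> b))\<^sup>2 + (cmod (\<psi> (b + 1)))\<^sup>2)) \<le> (\<Sum>j\<in>{a<..b}. d j)"
    by (smt (verit))
  then show ?thesis by (simp add: d_def sum_subtractf)
qed

section \<open>The walk as a product of two layers\<close>

definition walk :: "(int \<Rightarrow> complex^2^2) \<Rightarrow> (int \<Rightarrow> complex) \<Rightarrow> (int \<Rightarrow> complex)" where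
  "walk S = layer odd S \<circ> layer even S"

lemma walk_ell2: "unitary_blocks S \<Longrightarrow> \<psi> \<in> ell2 UNIV \<Longrightarrow> walk S \<psi> \<in> ell2 UNIV"
  by (simp add: walk_def layer_ell2)

lemma walk_inner:
  assumes "unitary_blocks S" "\<phi> \<in> ell2 UNIV" "\<psi> \<in> ell2 UNIV"
  shows "ell2_inner (walk S \<phi>) (walk S \<psi>) = ell2_inner \<phi> \<psi>"
  using assms by (simp add: walk_def layer_inner layer_ell2)

text \<open>The adjoint layers in reverse order; they provide the orbit at negative times.\<close>

definition walk_inverse :: "(int \<Rightarrow> complex^2^2) \<Rightarrow> (int \<Rightarrow> complex) \<Rightarrow> (int \<Rightarrow> complex)" where
  "walk_inverse S = layer even (adjoint_blocks S) \<circ> layer odd (adjoint_blocks S)"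

lemma walk_walk_inverse: "unitary_blocks S \<Longrightarrow> walk S (walk_inverse S \<psi>) = \<psi>"
  by (simp add: walk_def walk_inverse_def layer_adjoint_layer)

lemma walk_inverse_ell2:
  "unitary_blocks S \<Longrightarrow> \<psi> \<in> ell2 UNIV \<Longrightarrow> walk_inverse S \<psi> \<in> ell2 UNIV"
  by (simp add: walk_inverse_def layer_ell2 unitary_blocks_adjoint)

lemma walk_lincomb:
  "walk S (\<lambda>x. a * \<phi> x + b * \<psi> x) = (\<lambda>x. a * walk S \<phi> x + b * walk S \<psi> x)"
  by (simp add: walk_def layer_lincomb)

text \<open>Each layer charges the masses at \<open>k\<close> and \<open>k + 1\<close>. Those after
  the even layer are bounded by the original masses on \<open>k - 1, k, k + 1\<close> and on
  \<open>k, k + 1, k + 2\<close>, which together with the original masses at \<open>k\<close> and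
  \<open>k + 1\<close> gives the weights 1, 3, 3, 1 in \<open>L\<close>.\<close>

lemma walk_mass_loss:
  assumes S: "unitary_blocks S" and "a \<le> b"
  defines "m \<equiv> \<lambda>\<psi> j. (cmod (\<psi> j))\<^sup>2"
  defines "L \<equiv> \<lambda>\<psi> k. m \<psi> (k - 1) + 3 * m \<psi> k + 3 * m \<psi> (k + 1) + m \<psi> (k + 2)"
  shows "(\<Sum>j\<in>{a<..b}. m \<psi> j) \<le> (\<Sum>j\<in>{a<..b}. m (walk S \<psi>) j)
    + 2 * cmod (S a $ 1 $ 2) * L \<psi> a + 2 * cmod (S b $ 1 $ 2) * L \<psi> b"
proof -
  let ?\<phi> = "layer even S \<psi>"
  have bd: "2 * cmod (S k $ 1 $ 2) * (m \<psi> k + m \<psi> (k + 1))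
      + 2 * cmod (S k $ 1 $ 2) * (m ?\<phi> k + m ?\<phi> (k + 1)) \<le> 2 * cmod (S k $ 1 $ 2) * L \<psi> k" for k
  proof -
    have "m \<psi> k + m \<psi> (k + 1) + (m ?\<phi> k + m ?\<phi> (k + 1)) \<le> L \<psi> k"
      using layer_square_le[OF S, of even \<psi> k] layer_square_le[OF S, of even \<psi> "k + 1"]
      by (simp add: L_def m_def add.assoc)
    then have "2 * cmod (S k $ 1 $ 2) * (m \<psi> k + m \<psi> (k + 1) + (m ?\<phi> k + m ?\<phi> (k + 1)))
        \<le> 2 * cmod (S k $ 1 $ 2) * L \<psi> k"
      by (intro mult_left_mono) auto
    then show ?thesis by (simp add: algebra_simps)
  qed
  show ?thesis
    using layer_mass_loss[OF S _ \<open>a \<le> b\<close>, of even \<psi>] layer_mass_loss[OF S _ \<open>a \<le> b\<close>, of odd ?\<phi>]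
      bd[of a] bd[of b]
    by (simp add: walk_def m_def)
qed

section \<open>Trigonometric polynomials on the circle\<close>

text \<open>The power function of the circle, extended to the plane with modulus 1 everywhere. This
  keeps it bounded and multiplicative in \<open>n\<close> on all of the space on which the spectral
  measures live.\<close>

definition circle_char :: "int \<Rightarrow> complex \<Rightarrow> complex" where
  "circle_char n z = (if z = 0 then 1 else sgn z) powi n"

lemma circle_char_0 [simp]: "circle_char 0 z = 1"
  by (simp add: circle_char_def)

lemma circle_char_add: "circle_char (m + n) z = circle_char m z * circle_char n z"
  by (simp add: circle_char_def power_int_add sgn_zero_iff)

lemma norm_circle_char [simp]: "cmod (circle_char n z) = 1"
  by (simp add: circle_char_def norm_power_int norm_sgn)

lemma cnj_circle_char: "cnj (circle_char n z) = circle_char (- n) z"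
proof -
  have "circle_char n z * cnj (circle_char n z) = circle_char n z * circle_char (- n) z"
    using circle_char_add[of n "- n" z] by (simp flip: complex_norm_square)
  then show ?thesis
    by (metis mult_left_cancel norm_circle_char norm_zero zero_neq_one)
qed

lemma circle_char_on_sphere: "z \<in> sphere 0 1 \<Longrightarrow> circle_char n z = z powi n"
  by (auto simp: circle_char_def sgn_div_norm)

lemma circle_char_cis: "circle_char n (cis x) = cis (of_int n * x)"
  by (simp add: circle_char_on_sphere cis_power_int)

lemma borel_measurable_circle_char [measurable]: "circle_char n \<in> borel_measurable borel"
proof -
  have "(\<lambda>z::complex. if z = 0 then 1 else sgn z) \<in> borel_measurable borel"
    unfolding sgn_div_norm by measurable
  then show ?thesis
    unfolding circle_char_def[abs_def] power_int_def by measurable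
qed

section \<open>Fourier analysis for Lebesgue measure on the circle\<close>

lemma sets_circle_lebesgue [simp, measurable_cong]: "sets circle_lebesgue = sets borel"
  and space_circle_lebesgue [simp]: "space circle_lebesgue = UNIV"
  by (simp_all add: circle_lebesgue_def)

lemma measurable_cis_restrict [measurable]:
  "cis \<in> measurable (restrict_space lborel A) borel"
  by (intro measurable_restrict_space1) (simp add: borel_measurable_continuous_onI continuous_on_cis)

lemma finite_measure_circle_lebesgue: "finite_measure circle_lebesgue"
proof -
  have "emeasure lborel {0..<2 * pi} \<noteq> \<infinity>" by simp
  then have "finite_measure (restrict_space lborel {0..<2 * pi})"
    by (intro finite_measure_restrict_space finite_measureI)
       (auto simp: emeasure_restrict_space space_restrict_space intro!: finite_measureI)
  then show ?thesis
    unfolding circle_lebesgue_def by (rule finite_measure.finite_measure_distr) measurable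
qed

lemma integral_circle_char:
  "(\<integral>z. circle_char n z \<partial>circle_lebesgue) = (if n = 0 then 2 * pi else 0)"
proof -
  have "(\<integral>z. circle_char n z \<partial>circle_lebesgue)
      = (\<integral>x. indicator {0..<2 * pi} x *\<^sub>R cis (of_int n * x) \<partial>lborel)"
    unfolding circle_lebesgue_def
    by (simp add: integral_distr integral_restrict_space circle_char_cis)
  \<comment> \<open>Closing the interval adds a null set and makes the fundamental theorem of
    calculus applicable.\<close>
  also have "\<dots> = (\<integral>x. indicator {0..2 * pi} x *\<^sub>R cis (of_int n * x) \<partial>lborel)"
  proof (rule integral_cong_AE)
    have "AE x in lborel. x \<noteq> 2 * pi" by (rule AE_lborel_singleton)
    then show "AE x in lborel. indicator {0..<2 * pi} x *\<^sub>R cis (of_int n * x)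
        = indicator {0..2 * pi} x *\<^sub>R cis (of_int n * x)"
      by eventually_elim (auto simp: indicator_def)
  qed (auto intro!: borel_measurable_scaleR borel_measurable_indicator
      borel_measurable_continuous_onI[of "\<lambda>x. cis (of_int n * x)"] continuous_intros)
  also have "\<dots> = (if n = 0 then 2 * pi else 0)"
  proof (cases "n = 0")
    case False
    define F where "F x = cis (of_int n * x) / (\<i> * of_int n)" for x :: real
    have "(\<integral>x. indicator {0..2 * pi} x *\<^sub>R cis (of_int n * x) \<partial>lborel) = F (2 * pi) - F 0"
    proof (rule integral_FTC_Icc)
      fix x :: real
      have "((\<lambda>z. exp (\<i> * of_int n * z) / (\<i> * of_int n)) has_field_derivative exp (\<i> * of_int n * of_real x))
          (at (of_real x))"
        using False by (auto intro!: derivative_eq_intros)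
      from has_vector_derivative_real_field[OF this]
      show "(F has_vector_derivative cis (of_int n * x)) (at x within {0..2*pi})"
        unfolding F_def cis_conv_exp by (simp add: mult.assoc)
    qed (auto intro!: continuous_intros)
    moreover have "cis (of_int n * (2 * pi)) = 1"
      by (metis cis_multiple_2pi Ints_of_int mult.commute)
    ultimately show ?thesis using False by (simp add: F_def)
  qed (simp add: scaleR_conv_of_real)
  finally show ?thesis .
qed

lemma integrable_circle_char:
  assumes "finite_measure M" "sets M = sets borel"
  shows "integrable M (circle_char n)"
  by (rule finite_measure.integrable_const_bound[OF assms(1), of _ 1])
     (use assms in \<open>auto simp: measurable_cong_sets[OF assms(2) refl]\<close>)

text \<open>Orthogonality of the characters leaves the diagonal terms; \<open>2 * pi\<close> is the
  total mass of \<open>circle_lebesgue\<close>.\<close>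

lemma parseval_trig_poly:
  "(\<integral>z. (cmod (\<Sum>n<N. c n * circle_char (int n) z))\<^sup>2 \<partial>circle_lebesgue)
    = 2 * pi * (\<Sum>n<N. (cmod (c n))\<^sup>2)"
proof -
  note int = integrable_circle_char[OF finite_measure_circle_lebesgue sets_circle_lebesgue]
  have e: "complex_of_real ((cmod (\<Sum>n<N. c n * circle_char (int n) z))\<^sup>2)
      = (\<Sum>m<N. \<Sum>n<N. c m * cnj (c n) * circle_char (int m - int n) z)" for z
    using circle_char_add[of "int _" "- int _" z]
    by (simp add: complex_norm_square sum_product cnj_circle_char mult_ac del: of_real_power)
  have "complex_of_real (\<integral>z. (cmod (\<Sum>n<N. c n * circle_char (int n) z))\<^sup>2 \<partial>circle_lebesgue)
      = (\<integral>z. (\<Sum>m<N. \<Sum>n<N. c m * cnj (c n) * circle_char (int m - int n) z) \<partial>circle_lebesgue)"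
    by (simp only: integral_complex_of_real[symmetric] e)
  also have "\<dots> = (\<Sum>m<N. \<Sum>n<N. c m * cnj (c n) * (\<integral>z. circle_char (int m - int n) z \<partial>circle_lebesgue))"
    by (simp add: int)
  also have "\<dots> = (\<Sum>m<N. \<Sum>n<N. if m = n then c m * cnj (c n) * (2 * pi) else 0)"
    by (intro sum.cong refl) (auto simp: integral_circle_char)
  also have "\<dots> = complex_of_real (2 * pi * (\<Sum>n<N. (cmod (c n))\<^sup>2))"
    by (simp add: sum.delta sum_distrib_left complex_norm_square mult_ac del: of_real_power)
  finally show ?thesis using of_real_eq_iff by blast
qed

text \<open>Inner and outer regularity, each used with error \<open>e / 2\<close>; the pair of sets
  is the input for Urysohn's lemma.\<close>

lemma finite_measure_compact_open_approx:
  fixes M :: "'a::{second_countable_topology, complete_space} measure"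
  assumes "finite_measure M" "sets M = sets borel" "A \<in> sets borel" "0 < e"
  obtains K V where "compact K" "open V" "K \<subseteq> A" "A \<subseteq> V" "measure M (V - K) < e"
proof -
  interpret finite_measure M by fact
  have fin: "emeasure M (space M) \<noteq> \<infinity>" by simp
  have A: "A \<in> sets M" using assms by simp
  have "\<exists>K. K \<subseteq> A \<and> compact K \<and> measure M A < measure M K + e / 2"
  proof (rule ccontr)
    assume no: "\<not> ?thesis"
    then have le: "measure M K \<le> measure M A - e / 2" if "K \<subseteq> A" "compact K" for K
      using that no by (meson le_diff_eq not_le)
    have "emeasure M A = (SUP K \<in> {K. K \<subseteq> A \<and> compact K}. emeasure M K)"
      using assms fin by (intro inner_regular)
    also have "\<dots> \<le> ennreal (measure M A - e / 2)"
      by (rule SUP_least) (auto simp: emeasure_eq_measure intro!: ennreal_leI le)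
    finally have "measure M A \<le> measure M A - e / 2"
      using le[of "{}"] by (simp add: emeasure_eq_measure)
    then show False using \<open>0 < e\<close> by simp
  qed
  then obtain K where K: "K \<subseteq> A" "compact K" "measure M A < measure M K + e / 2" by blast
  have "\<exists>V. A \<subseteq> V \<and> open V \<and> measure M V < measure M A + e / 2"
  proof (rule ccontr)
    assume no: "\<not> ?thesis"
    then have le: "measure M A + e / 2 \<le> measure M V" if "A \<subseteq> V" "open V" for V
      using that no by (meson not_le)
    have "ennreal (measure M A + e / 2) \<le> (INF V \<in> {V. A \<subseteq> V \<and> open V}. emeasure M V)"
      by (rule INF_greatest) (auto simp: emeasure_eq_measure intro!: ennreal_leI le)
    also have "\<dots> = emeasure M A"
      using assms fin by (intro outer_regular[symmetric])
    finally have "measure M A + e / 2 \<le> measure M A"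
      by (simp add: emeasure_eq_measure)
    then show False using \<open>0 < e\<close> by simp
  qed
  then obtain V where V: "A \<subseteq> V" "open V" "measure M V < measure M A + e / 2" by blast
  have "measure M (V - K) = measure M V - measure M K"
    using K V assms by (intro finite_measure_Diff) (auto intro: borel_compact)
  then show thesis using K V by (intro that[of K V]) auto
qed

section \<open>Functional calculus on an orbit\<close>

lemma borel_measurable_cnj [measurable (raw)]:
  "f \<in> borel_measurable M \<Longrightarrow> (\<lambda>x. cnj (f x)) \<in> borel_measurable M"
  by (rule measurable_compose[OF _ borel_measurable_continuous_onI]) (auto intro: continuous_intros)

text \<open>The vectors \<open>v n\<close> stand for the powers of \<open>T\<close> applied to
  \<open>v 0\<close>, indexed by all integers so that trigonometric polynomials with negative
  frequencies can act. The last assumption says that sending \<open>v n\<close> to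
  \<open>circle_char n\<close> preserves inner products into the space of square-integrable
  functions for \<open>\<mu>\<close>.\<close>

locale unitary_orbit =
  fixes T :: "('a \<Rightarrow> complex) \<Rightarrow> ('a \<Rightarrow> complex)"
    and v :: "int \<Rightarrow> 'a \<Rightarrow> complex"
    and \<mu> :: "complex measure"
  assumes T_lincomb: "\<And>a b \<phi> \<psi>. T (\<lambda>x. a * \<phi> x + b * \<psi> x) = (\<lambda>x. a * T \<phi> x + b * T \<psi> x)"
    and T_orbit: "\<And>n. T (v n) = v (n + 1)"
    and orbit_ell2: "\<And>n. v n \<in> ell2 UNIV"
    and finite_mu: "finite_measure \<mu>"
    and sets_mu: "sets \<mu> = sets borel"
    and sphere_mu: "AE z in \<mu>. z \<in> sphere 0 1"
    and orbit_inner: "\<And>m n. ell2_inner (v m) (v n) = (\<integral>z. circle_char (n - m) z \<partial>\<mu>)"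
begin

text \<open>\<open>calculus \<phi> h\<close> says that \<open>\<phi> = h(T) v\<^sub>0\<close> for the trigonometric polynomial \<open>h\<close>.\<close>

inductive calculus :: "('a \<Rightarrow> complex) \<Rightarrow> (complex \<Rightarrow> complex) \<Rightarrow> bool" where
  char: "calculus (v n) (circle_char n)"
| lincomb: "calculus \<phi> g \<Longrightarrow> calculus \<psi> h \<Longrightarrow>
    calculus (\<lambda>x. a * \<phi> x + b * \<psi> x) (\<lambda>z. a * g z + b * h z)"

lemma calculus_ell2: "calculus \<phi> h \<Longrightarrow> \<phi> \<in> ell2 UNIV"
  by (induction rule: calculus.induct) (auto intro: orbit_ell2 ell2_lincomb)

lemma calculus_measurable: "calculus \<phi> h \<Longrightarrow> h \<in> borel_measurable borel"
  by (induction rule: calculus.induct) auto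

lemma calculus_bounded: "calculus \<phi> h \<Longrightarrow> \<exists>B. \<forall>z. cmod (h z) \<le> B"
proof (induction rule: calculus.induct)
  case (lincomb \<phi> g \<psi> h a b)
  then obtain B C where "\<And>z. cmod (g z) \<le> B" "\<And>z. cmod (h z) \<le> C" by auto
  then have "cmod (a * g z + b * h z) \<le> cmod a * B + cmod b * C" for z
    by (intro order_trans[OF norm_triangle_ineq] add_mono) (auto simp: norm_mult intro: mult_left_mono)
  then show ?case by auto
qed (auto intro: exI[of _ 1])

lemma integrable_bounded:
  fixes h :: "complex \<Rightarrow> 'b::{banach, second_countable_topology}"
  assumes "h \<in> borel_measurable borel" "\<And>z. norm (h z) \<le> B"
  shows "integrable \<mu> h"
  by (rule finite_measure.integrable_const_bound[OF finite_mu, of _ B])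
     (use assms sets_mu in \<open>auto simp: measurable_cong_sets[OF sets_mu refl]\<close>)

lemma calculus_integrable:
  assumes "calculus \<phi> g" "calculus \<psi> h"
  shows "integrable \<mu> (\<lambda>z. cnj (g z) * h z)"
proof -
  note [measurable] = calculus_measurable[OF assms(1)] calculus_measurable[OF assms(2)]
  obtain B C where B: "\<And>z. cmod (g z) \<le> B" "\<And>z. cmod (h z) \<le> C"
    using calculus_bounded assms by metis
  have "0 \<le> B" using B(1)[of 0] norm_ge_zero order_trans by blast
  then have "norm (cnj (g z) * h z) \<le> B * C" for z
    using B by (auto simp: norm_mult intro!: mult_mono)
  moreover have "(\<lambda>z. cnj (g z) * h z) \<in> borel_measurable borel" by measurable
  ultimately show ?thesis by (intro integrable_bounded)
qed

text \<open>Sesquilinear extension of \<open>orbit_inner\<close>: the outer induction treats the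
  left vector, the inner one the right vector.\<close>

lemma calculus_inner:
  assumes "calculus \<phi> g" "calculus \<psi> h"
  shows "ell2_inner \<phi> \<psi> = (\<integral>z. cnj (g z) * h z \<partial>\<mu>)"
  using assms
proof (induction arbitrary: \<psi> h rule: calculus.induct)
  case (char m)
  then show ?case
  proof (induction rule: calculus.induct)
    case (char n)
    show ?case by (simp add: orbit_inner cnj_circle_char flip: circle_char_add)
  next
    case (lincomb \<phi> g \<psi> h a b)
    have "ell2_inner (v m) (\<lambda>x. a * \<phi> x + b * \<psi> x)
        = a * (\<integral>z. cnj (circle_char m z) * g z \<partial>\<mu>) + b * (\<integral>z. cnj (circle_char m z) * h z \<partial>\<mu>)"
      using lincomb by (simp add: ell2_inner_lincomb_right[of _ UNIV] orbit_ell2 calculus_ell2)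
    also have "\<dots> = (\<integral>z. a * (cnj (circle_char m z) * g z) + b * (cnj (circle_char m z) * h z) \<partial>\<mu>)"
      using calculus_integrable[OF calculus.char[of m] lincomb.hyps(1)]
        calculus_integrable[OF calculus.char[of m] lincomb.hyps(2)] by simp
    finally show ?case by (simp add: algebra_simps)
  qed
next
  case (lincomb \<phi> g \<xi> k a b)
  \<comment> \<open>Conjugate symmetry moves the linear combination into the second slot, where
    linearity is available.\<close>
  have "ell2_inner (\<lambda>x. a * \<phi> x + b * \<xi> x) \<psi> = cnj (a * ell2_inner \<psi> \<phi> + b * ell2_inner \<psi> \<xi>)"
    using lincomb by (subst ell2_inner_commute)
      (simp add: ell2_inner_lincomb_right[of _ UNIV] calculus_ell2)
  also have "\<dots> = cnj a * (\<integral>z. cnj (g z) * h z \<partial>\<mu>) + cnj b * (\<integral>z. cnj (k z) * h z \<partial>\<mu>)"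
    using lincomb.IH[OF lincomb.prems] by (simp flip: ell2_inner_commute)
  also have "\<dots> = (\<integral>z. cnj a * (cnj (g z) * h z) + cnj b * (cnj (k z) * h z) \<partial>\<mu>)"
    using calculus_integrable[OF lincomb.hyps(1) lincomb.prems]
      calculus_integrable[OF lincomb.hyps(2) lincomb.prems] by simp
  finally show ?case by (simp add: algebra_simps)
qed

lemma calculus_integrable_square: "calculus \<phi> h \<Longrightarrow> integrable \<mu> (\<lambda>z. (cmod (h z))\<^sup>2)"
  using integrable_norm[OF calculus_integrable, of \<phi> h \<phi> h] by (simp add: norm_mult power2_eq_square)

text \<open>Turns an estimate for \<open>h\<close> in the mean square with respect to
  \<open>\<mu>\<close> into one for the values of the vector at sites.\<close>

lemma calculus_sum_square_le:
  assumes "calculus \<phi> h" "finite F"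
  shows "(\<Sum>x\<in>F. (cmod (\<phi> x))\<^sup>2) \<le> (\<integral>z. (cmod (h z))\<^sup>2 \<partial>\<mu>)"
proof -
  have "ell2_inner \<phi> \<phi> = (\<integral>z. complex_of_real ((cmod (h z))\<^sup>2) \<partial>\<mu>)"
    using calculus_inner[OF assms(1,1)] by (simp add: complex_norm_square mult.commute del: of_real_power)
  then have "Re (ell2_inner \<phi> \<phi>) = (\<integral>z. (cmod (h z))\<^sup>2 \<partial>\<mu>)"
    by (simp only: integral_complex_of_real Re_complex_of_real)
  then show ?thesis
    using ell2_sum_square_le_inner[OF calculus_ell2[OF assms(1)] assms(2)] by simp
qed

text \<open>In the spectral representation \<open>T\<close> is multiplication by the first
  character.\<close>

lemma calculus_shift: "calculus \<phi> h \<Longrightarrow> calculus (T \<phi>) (\<lambda>z. circle_char 1 z * h z)"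
proof (induction rule: calculus.induct)
  case (char n)
  show ?case
    using calculus.char[of "n + 1"] by (simp add: T_orbit circle_char_add[abs_def] mult.commute)
next
  case (lincomb \<phi> g \<psi> h a b)
  from calculus.lincomb[OF lincomb.IH, of a b] show ?case
    by (simp add: T_lincomb algebra_simps)
qed

lemma calculus_shift_funpow:
  assumes "calculus \<phi> h"
  shows "calculus ((T ^^ n) \<phi>) (\<lambda>z. circle_char (int n) z * h z)"
proof (induction n)
  case (Suc n)
  from calculus_shift[OF this] show ?case
    using circle_char_add[of 1 "int n"] by (simp add: mult_ac)
qed (use assms in simp)

lemma calculus_sum:
  fixes N :: nat
  assumes "\<And>n. calculus (\<phi> n) (h n)"
  shows "calculus (\<lambda>x. \<Sum>n<N. c n * \<phi> n x) (\<lambda>z. \<Sum>n<N. c n * h n z)"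
proof (induction N)
  case 0
  \<comment> \<open>The zero vector is produced as a combination with both coefficients 0.\<close>
  from calculus.lincomb[OF calculus.char[of 0] calculus.char[of 0], of 0 0] show ?case by simp
next
  case (Suc N)
  from calculus.lincomb[OF this assms[of N], of 1 "c N"] show ?case by simp
qed

lemma calculus_mult:
  assumes "calculus \<phi> g" "calculus \<psi> h"
  shows "\<exists>\<eta>. calculus \<eta> (\<lambda>z. g z * h z)"
  using assms
proof (induction arbitrary: \<psi> h rule: calculus.induct)
  case (char m)
  then show ?case
  proof (induction rule: calculus.induct)
    case (char n)
    show ?case using calculus.char[of "m + n"] by (auto simp: circle_char_add[abs_def])
  next
    case (lincomb \<phi> g \<psi> h a b)
    then obtain \<eta> \<zeta> where "calculus \<eta> (\<lambda>z. circle_char m z * g z)" "calculus \<zeta> (\<lambda>z. circle_char m z * h z)"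
      by auto
    from calculus.lincomb[OF this, of a b] show ?case by (auto simp: algebra_simps)
  qed
next
  case (lincomb \<phi> g \<xi> k a b)
  then obtain \<eta> \<zeta> where "calculus \<eta> (\<lambda>z. g z * h z)" "calculus \<zeta> (\<lambda>z. k z * h z)"
    by metis
  from calculus.lincomb[OF this, of a b] show ?case by (auto simp: algebra_simps)
qed

section \<open>Approximation of indicator functions by trigonometric polynomials\<close>

text \<open>On the circle the conjugate of \<open>z\<close> is its inverse, so real and imaginary
  parts are combinations of the characters of index 1 and -1; sums and products stay in the
  calculus.\<close>

lemma calculus_real_polynomial:
  assumes "real_polynomial_function (p :: complex \<Rightarrow> real)"
  shows "\<exists>\<phi> h. calculus \<phi> h \<and> (\<forall>z\<in>sphere 0 1. h z = of_real (p z))"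
  using assms
proof (induction rule: real_polynomial_function.induct)
  case (linear f)
  interpret bounded_linear f by fact
  define a b where "a = complex_of_real (f 1)" and "b = complex_of_real (f \<i>)"
  have f: "of_real (f z) = ((a - \<i> * b) / 2) * circle_char 1 z + ((a + \<i> * b) / 2) * circle_char (- 1) z"
    if "z \<in> sphere 0 1" for z
  proof -
    have "z = Re z *\<^sub>R 1 + Im z *\<^sub>R \<i>" by (simp add: complex_eq_iff)
    then have "f z = Re z * f 1 + Im z * f \<i>"
      by (metis add scaleR real_scaleR_def)
    then have "of_real (f z) = of_real (Re z) * a + of_real (Im z) * b"
      by (simp add: a_def b_def)
    moreover have "of_real (Re z) = (z + cnj z) / 2" "of_real (Im z) = - \<i> * (z - cnj z) / 2"
      by (auto simp: complex_eq_iff)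
    moreover have "circle_char 1 z = z" "circle_char (- 1) z = cnj z"
      using that cnj_circle_char[of 1 z] by (simp_all add: circle_char_on_sphere[OF that])
    ultimately show ?thesis by (simp add: field_simps)
  qed
  show ?case
    using calculus.lincomb[OF calculus.char[of 1] calculus.char[of "- 1"], of "(a - \<i> * b) / 2" "(a + \<i> * b) / 2"] f
    by fastforce
next
  case (const c)
  show ?case
    using calculus.lincomb[OF calculus.char[of 0] calculus.char[of 0], of c 0] by fastforce
next
  case (add p q)
  then obtain \<phi> g \<psi> h where "calculus \<phi> g" "calculus \<psi> h"
    "\<forall>z\<in>sphere 0 1. g z = of_real (p z)" "\<forall>z\<in>sphere 0 1. h z = of_real (q z)" by auto
  with calculus.lincomb[of \<phi> g \<psi> h 1 1] show ?case by fastforce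
next
  case (mult p q)
  then obtain \<phi> g \<psi> h where gh: "calculus \<phi> g" "calculus \<psi> h"
    "\<forall>z\<in>sphere 0 1. g z = of_real (p z)" "\<forall>z\<in>sphere 0 1. h z = of_real (q z)" by auto
  then show ?case using calculus_mult[OF gh(1,2)] by fastforce
qed

text \<open>Regularity of \<open>\<mu>\<close>, Urysohn's lemma and the Stone-Weierstrass theorem in
  turn replace the indicator by a pair of sets, a continuous function and a polynomial.\<close>

lemma calculus_approx_indicator:
  assumes A: "A \<in> sets borel" and "0 < e"
  shows "\<exists>\<phi> h. calculus \<phi> h \<and> (\<integral>z. (cmod (h z - indicator A z))\<^sup>2 \<partial>\<mu>) \<le> e"
proof -
  interpret finite_measure \<mu> by (rule finite_mu)
  define m where "m = measure \<mu> (space \<mu>)"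
  have m: "0 \<le> m" by (simp add: m_def)
  \<comment> \<open>Uniform error for the polynomial: it contributes at most \<open>e / 2\<close> to
    the integral, and \<open>V - K\<close> the other half. The summand 1 avoids division by zero for
    the zero measure.\<close>
  define d where "d = sqrt (e / (4 * (m + 1)))"
  have d: "0 < d" using \<open>0 < e\<close> m by (simp add: d_def)
  have d2: "2 * d\<^sup>2 * m \<le> e / 2"
  proof -
    have "d\<^sup>2 = e / (4 * (m + 1))" using \<open>0 < e\<close> m by (simp add: d_def)
    moreover have "m + 1 \<noteq> 0" using m by simp
    ultimately have "2 * d\<^sup>2 * m = (e / 2) * (m / (m + 1))" by (simp add: field_simps)
    also have "\<dots> \<le> (e / 2) * 1" using \<open>0 < e\<close> m by (intro mult_left_mono) auto
    finally show ?thesis by simp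
  qed
  obtain K V where KV: "compact K" "open V" "K \<subseteq> A" "A \<subseteq> V" "measure \<mu> (V - K) < e / 4"
    using finite_measure_compact_open_approx[OF finite_mu sets_mu A, of "e / 4"] \<open>0 < e\<close> by auto
  obtain g :: "complex \<Rightarrow> real" where g: "continuous_on UNIV g" "\<And>z. g z \<in> closed_segment 1 0"
    "\<And>z. z \<in> K \<Longrightarrow> g z = 1" "\<And>z. z \<in> - V \<Longrightarrow> g z = 0"
    by (rule Urysohn[of K "- V" "1::real" 0]) (use KV in \<open>auto intro: compact_imp_closed\<close>)
  obtain p :: "complex \<Rightarrow> real" where p: "real_polynomial_function p"
    "\<And>z. z \<in> sphere 0 1 \<Longrightarrow> \<bar>g z - p z\<bar> < d"
    using Stone_Weierstrass_real_polynomial_function[of "sphere 0 1" g d] d g(1)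
      continuous_on_subset[OF g(1), of "sphere 0 1"] by auto
  obtain \<phi> h where h: "calculus \<phi> h" "\<And>z. z \<in> sphere 0 1 \<Longrightarrow> h z = of_real (p z)"
    using calculus_real_polynomial[OF p(1)] by blast
  note [measurable] = calculus_measurable[OF h(1)]
  have VK: "V - K \<in> sets borel" using KV by (auto intro: borel_compact)
  have VK': "V - K \<in> sets \<mu>" using VK sets_mu by simp
  then have int_VK: "integrable \<mu> (indicator (V - K) :: complex \<Rightarrow> real)"
    by (rule integrable_real_indicator) (simp flip: less_top)
  have "(\<integral>z. (cmod (h z - indicator A z))\<^sup>2 \<partial>\<mu>) \<le> (\<integral>z. 2 * d\<^sup>2 + 2 * indicator (V - K) z \<partial>\<mu>)"
  proof (rule integral_mono_AE')
    show "integrable \<mu> (\<lambda>z. 2 * d\<^sup>2 + 2 * indicator (V - K) z :: real)"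
      using int_VK by simp
    show "AE z in \<mu>. (cmod (h z - indicator A z))\<^sup>2 \<le> 2 * d\<^sup>2 + 2 * indicator (V - K) z"
      using sphere_mu
    proof eventually_elim
      case (elim z)
      have "cmod (h z - of_real (g z)) \<le> d"
        using p(2)[OF elim] by (simp add: h(2)[OF elim] abs_minus_commute flip: of_real_diff)
      then have 1: "(cmod (h z - of_real (g z)))\<^sup>2 \<le> d\<^sup>2" by (intro power_mono) auto
      \<comment> \<open>Both functions equal 1 on \<open>K\<close> and 0 off \<open>V\<close>, and
        take values between 0 and 1 in between.\<close>
      have "\<bar>g z - indicator A z\<bar> \<le> indicator (V - K) z"
        using g(2)[of z] g(3)[of z] g(4)[of z] KV(3,4)
        by (auto simp: indicator_def closed_segment_eq_real_ivl)
      then have "\<bar>g z - indicator A z\<bar>\<^sup>2 \<le> (indicator (V - K) z)\<^sup>2" by (intro power_mono) auto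
      also have "(indicator (V - K) z :: real)\<^sup>2 = indicator (V - K) z" by (simp add: indicator_def)
      also have "\<bar>g z - indicator A z\<bar> = cmod (of_real (g z) - of_real (indicator A z))"
        by (metis norm_of_real of_real_diff)
      also have "complex_of_real (indicator A z) = indicator A z" by (simp add: indicator_def)
      finally have 2: "(cmod (of_real (g z) - indicator A z))\<^sup>2 \<le> indicator (V - K) z" .
      have "(cmod (h z - indicator A z))\<^sup>2
          \<le> 2 * (cmod (h z - of_real (g z)))\<^sup>2 + 2 * (cmod (of_real (g z) - indicator A z))\<^sup>2"
        using cmod_add_square_le[of "h z - of_real (g z)" "of_real (g z) - indicator A z"] by simp
      with 1 2 show ?case by linarith
    qed
  qed auto
  also have "\<dots> = 2 * d\<^sup>2 * m + 2 * measure \<mu> (V - K)"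
    using VK' int_VK by (simp add: m_def)
  also have "\<dots> \<le> e" using d2 KV(5) by simp
  finally show ?thesis using h(1) by blast
qed

section \<open>Truncation to sublevel sets of the spectral density\<close>

text \<open>On the sublevel set \<open>\<mu>\<close> is dominated by \<open>M\<close> times Lebesgue
  measure. The comparison runs through nonnegative integrals because \<open>f\<close> has values in
  the extended nonnegative reals.\<close>

lemma density_sublevel_integral_le:
  assumes f: "f \<in> borel_measurable circle_lebesgue" "density circle_lebesgue f = \<mu>"
    and q: "q \<in> borel_measurable borel" "\<And>z. 0 \<le> q z" "\<And>z. q z \<le> C"
  shows "(\<integral>z. indicator {z. f z \<le> of_nat M} z * q z \<partial>\<mu>) \<le> real M * (\<integral>z. q z \<partial>circle_lebesgue)"
proof -
  note [measurable] = f(1) q(1)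
  let ?A = "{z. f z \<le> of_nat M}"
  have A: "?A \<in> sets borel" by measurable
  have Aq [measurable]: "(\<lambda>z. indicator ?A z * q z) \<in> borel_measurable borel" using A by measurable
  have int: "integrable circle_lebesgue q"
    by (rule finite_measure.integrable_const_bound[OF finite_measure_circle_lebesgue, of _ C])
       (use q in auto)
  have "ennreal (\<integral>z. indicator ?A z * q z \<partial>\<mu>) = (\<integral>\<^sup>+z. ennreal (indicator ?A z * q z) \<partial>\<mu>)"
    using q by (intro nn_integral_eq_integral[symmetric] integrable_bounded[of _ C] Aq)
      (auto simp: indicator_def intro: order_trans)
  also have "\<dots> = (\<integral>\<^sup>+z. f z * ennreal (indicator ?A z * q z) \<partial>circle_lebesgue)"
    unfolding f(2)[symmetric] by (rule nn_integral_density) measurable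
  also have "\<dots> \<le> (\<integral>\<^sup>+z. of_nat M * ennreal (q z) \<partial>circle_lebesgue)"
    by (intro nn_integral_mono) (auto simp: indicator_def intro: mult_right_mono)
  also have "\<dots> = of_nat M * (\<integral>\<^sup>+z. ennreal (q z) \<partial>circle_lebesgue)"
    by (rule nn_integral_cmult) measurable
  also have "\<dots> = of_nat M * ennreal (\<integral>z. q z \<partial>circle_lebesgue)"
    using int q by (subst nn_integral_eq_integral) auto
  also have "\<dots> = ennreal (real M * (\<integral>z. q z \<partial>circle_lebesgue))"
    by (simp add: ennreal_mult' ennreal_of_nat_eq_real_of_nat)
  finally show ?thesis
    using q by (subst (asm) ennreal_le_iff) auto
qed

text \<open>The superlevel sets decrease to the set where \<open>f\<close> is infinite. That set is
  null since \<open>\<mu>\<close> is finite, so continuity from above applies.\<close>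

lemma density_superlevel_small:
  assumes f: "f \<in> borel_measurable circle_lebesgue" "density circle_lebesgue f = \<mu>" and "0 < e"
  shows "\<exists>M::nat. measure \<mu> (- {z. f z \<le> of_nat M}) < e"
proof -
  interpret finite_measure \<mu> by (rule finite_mu)
  note [measurable] = f(1)
  let ?B = "\<lambda>M::nat. - {z. f z \<le> of_nat M}"
  have B: "?B M \<in> sets \<mu>" for M unfolding sets_mu by measurable
  have "(\<integral>\<^sup>+z. f z \<partial>circle_lebesgue) = emeasure \<mu> UNIV"
    unfolding f(2)[symmetric] by (subst emeasure_density) auto
  also have "\<dots> \<noteq> \<infinity>" by simp
  finally have "AE z in circle_lebesgue. f z \<noteq> \<infinity>"
    by (intro nn_integral_PInf_AE) auto
  then have "AE z in \<mu>. f z \<noteq> \<infinity>"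
    unfolding f(2)[symmetric] by (subst AE_density) auto
  moreover have "(\<Inter>M. ?B M) = {z. f z = \<infinity>}"
    by (auto simp: not_le)
       (meson ennreal_Ex_less_of_nat less_asym top.not_eq_extremum, metis of_nat_less_top not_le)
  moreover have "{z. f z = \<infinity>} \<in> sets \<mu>" unfolding sets_mu by measurable
  ultimately have "measure \<mu> (\<Inter>M. ?B M) = 0"
    by (intro measure_eq_0_null_sets) (simp add: AE_iff_null_sets)
  moreover have "decseq ?B"
    by (auto simp: decseq_def not_le) (meson order_trans of_nat_mono)
  ultimately have "(\<lambda>M. measure \<mu> (?B M)) \<longlonglongrightarrow> 0"
    using finite_Lim_measure_decseq[of ?B] B by auto
  then have "eventually (\<lambda>M. measure \<mu> (?B M) < e) sequentially"
    using \<open>0 < e\<close> by (rule order_tendstoD)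
  then show ?thesis by (auto simp: eventually_sequentially)
qed

text \<open>The bound \<open>B\<close> comes from a bound on the spectral density of the truncated vector and is
  therefore independent of the number \<open>N\<close> of time steps, although the vector is not.\<close>

lemma absolutely_continuous_truncation:
  assumes ac: "absolutely_continuous circle_lebesgue \<mu>" and "0 < e"
  shows "\<exists>B. \<forall>N. \<exists>\<phi> h. calculus \<phi> h \<and>
    (\<forall>F. finite F \<longrightarrow> (\<Sum>x\<in>F. (cmod (\<phi> x - v 0 x))\<^sup>2) \<le> e) \<and>
    (\<forall>k. (\<Sum>n<N. (cmod ((T ^^ n) \<phi> k))\<^sup>2) \<le> B)"
proof -
  interpret finite_measure \<mu> by (rule finite_mu)
  interpret leb: finite_measure circle_lebesgue by (rule finite_measure_circle_lebesgue)
  obtain f where f: "f \<in> borel_measurable circle_lebesgue" "density circle_lebesgue f = \<mu>"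
    using leb.Radon_Nikodym[OF ac] sets_mu by auto
  note [measurable] = f(1)
  obtain M :: nat where M: "measure \<mu> (- {z. f z \<le> of_nat M}) < e / 4"
    using density_superlevel_small[OF f, of "e / 4"] \<open>0 < e\<close> by auto
  define A where "A = {z. f z \<le> of_nat M}"
  have A [measurable]: "A \<in> sets borel" unfolding A_def by measurable
  have A': "A \<in> sets \<mu>" "- A \<in> sets \<mu>" using A sets_mu by auto
  define m where "m = measure \<mu> (space \<mu>)"
  \<comment> \<open>Bound for the mean square of \<open>h\<close>: twice the approximation error
    \<open>d \<le> 1\<close> plus twice the mass of \<open>A\<close>.\<close>
  define K where "K = 2 + 2 * m"
  have K: "2 \<le> K" by (simp add: K_def m_def)
  define B where "B = 1 + 4 * pi * M"
  have B: "1 \<le> B" by (simp add: B_def)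
  show ?thesis
  proof (intro exI[of _ B] allI)
    fix N :: nat
    \<comment> \<open>The accuracy may depend on \<open>N\<close>: the last term outweighs the bound
      \<open>N\<^sup>2 * K\<close> on \<open>q\<close> below, and its summand 2 keeps the
      denominator positive. The bound \<open>e / 4\<close> makes the vector close to
      \<open>v 0\<close>.\<close>
    define d where "d = min (min 1 (e / 4)) (1 / (2 * (real N)\<^sup>2 * K + 2))"
    have NK: "0 < 2 * (real N)\<^sup>2 * K + 2" using K by (intro add_nonneg_pos) auto
    have d: "0 < d" "d \<le> 1" "d \<le> e / 4" using NK \<open>0 < e\<close> by (auto simp: d_def)
    have dN: "2 * ((real N)\<^sup>2 * K) * d \<le> 1"
    proof -
      have "2 * ((real N)\<^sup>2 * K) * d \<le> (2 * (real N)\<^sup>2 * K + 2) * d"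
        using d by (simp add: algebra_simps)
      also have "\<dots> \<le> (2 * (real N)\<^sup>2 * K + 2) * (1 / (2 * (real N)\<^sup>2 * K + 2))"
        using NK by (intro mult_left_mono) (auto simp: d_def)
      also have "\<dots> = 1" using NK by simp
      finally show ?thesis .
    qed
    obtain \<phi> h where h: "calculus \<phi> h" "(\<integral>z. (cmod (h z - indicator A z))\<^sup>2 \<partial>\<mu>) \<le> d"
      using calculus_approx_indicator[OF A d(1)] by blast
    note [measurable] = calculus_measurable[OF h(1)]
    obtain C where C: "\<And>z. cmod (h z) \<le> C" using calculus_bounded[OF h(1)] by blast
    have sq_bound: "(cmod (h z - indicator A z))\<^sup>2 \<le> (C + 1)\<^sup>2" for z
      by (intro power_mono order_trans[OF norm_triangle_ineq4] add_mono C) (auto simp: indicator_def)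
    have int_sq: "integrable \<mu> (\<lambda>z. (cmod (h z - indicator A z))\<^sup>2)"
      using sq_bound by (intro integrable_bounded[of _ "(C + 1)\<^sup>2"]) auto
    have int_ind: "integrable \<mu> (indicator A :: complex \<Rightarrow> real)"
      "integrable \<mu> (indicator (- A) :: complex \<Rightarrow> real)"
      using A' by (auto intro!: integrable_real_indicator simp flip: less_top)
    have h_norm: "(\<integral>z. (cmod (h z))\<^sup>2 \<partial>\<mu>) \<le> K"
    proof -
      have "(\<integral>z. (cmod (h z))\<^sup>2 \<partial>\<mu>) \<le> (\<integral>z. 2 * (cmod (h z - indicator A z))\<^sup>2 + 2 * indicator A z \<partial>\<mu>)"
      proof (rule integral_mono)
        fix z
        show "(cmod (h z))\<^sup>2 \<le> 2 * (cmod (h z - indicator A z))\<^sup>2 + 2 * indicator A z"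
          using cmod_add_square_le[of "h z - indicator A z" "indicator A z"]
          by (auto simp: indicator_def)
      qed (use calculus_integrable_square[OF h(1)] int_sq int_ind in auto)
      also have "\<dots> = 2 * (\<integral>z. (cmod (h z - indicator A z))\<^sup>2 \<partial>\<mu>) + 2 * measure \<mu> A"
        using int_sq int_ind A' by simp
      also have "\<dots> \<le> K"
        using h(2) d bounded_measure[of A] by (simp add: K_def m_def)
      finally show ?thesis .
    qed
    have close: "(\<Sum>x\<in>F. (cmod (\<phi> x - v 0 x))\<^sup>2) \<le> e" if "finite F" for F
    proof -
      have rep: "calculus (\<lambda>x. \<phi> x - v 0 x) (\<lambda>z. h z - 1)"
        using calculus.lincomb[OF h(1) calculus.char[of 0], of 1 "- 1"] by simp
      have "(\<Sum>x\<in>F. (cmod (\<phi> x - v 0 x))\<^sup>2) \<le> (\<integral>z. (cmod (h z - 1))\<^sup>2 \<partial>\<mu>)"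
        by (rule calculus_sum_square_le[OF rep that])
      also have "\<dots> \<le> (\<integral>z. 2 * (cmod (h z - indicator A z))\<^sup>2 + 2 * indicator (- A) z \<partial>\<mu>)"
      proof (rule integral_mono)
        fix z
        show "(cmod (h z - 1))\<^sup>2 \<le> 2 * (cmod (h z - indicator A z))\<^sup>2 + 2 * indicator (- A) z"
          using cmod_add_square_le[of "h z - indicator A z" "indicator A z - 1"]
          by (auto simp: indicator_def)
      qed (use calculus_integrable_square[OF rep] int_sq int_ind in auto)
      also have "\<dots> = 2 * (\<integral>z. (cmod (h z - indicator A z))\<^sup>2 \<partial>\<mu>) + 2 * measure \<mu> (- A)"
        using int_sq int_ind A' by simp
      also have "\<dots> \<le> e" using h(2) d M by (simp add: A_def)
      finally show ?thesis .
    qed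
    have "(\<Sum>n<N. (cmod ((T ^^ n) \<phi> k))\<^sup>2) \<le> B" for k
    proof -
      \<comment> \<open>Duality: with these coefficients the combination of the iterates has at
        \<open>k\<close> the value \<open>S\<close>, the very sum to be bounded.\<close>
      define c where "c n = cnj ((T ^^ n) \<phi> k)" for n
      define S where "S = (\<Sum>n<N. (cmod (c n))\<^sup>2)"
      define q where "q z = (cmod (\<Sum>n<N. c n * circle_char (int n) z))\<^sup>2" for z
      have q [measurable]: "q \<in> borel_measurable borel" unfolding q_def[abs_def] by measurable
      have c: "(cmod (c n))\<^sup>2 \<le> K" for n
        using calculus_sum_square_le[OF calculus_shift_funpow[OF h(1), of n], of "{k}"] h_norm
        by (simp add: c_def norm_mult)
      have q_le: "q z \<le> (real N)\<^sup>2 * K" for z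
      proof -
        have "cmod (\<Sum>n<N. c n * circle_char (int n) z) \<le> (\<Sum>n<N. sqrt K)"
          using c by (intro sum_norm_le) (simp add: norm_mult real_le_rsqrt)
        then have "q z \<le> (real N * sqrt K)\<^sup>2"
          unfolding q_def by (intro power_mono) auto
        then show ?thesis using K by (simp add: power_mult_distrib)
      qed
      have q0: "0 \<le> q z" for z by (simp add: q_def)
      have rep: "calculus (\<lambda>x. \<Sum>n<N. c n * (T ^^ n) \<phi> x)
          (\<lambda>z. \<Sum>n<N. c n * (circle_char (int n) z * h z))"
        by (rule calculus_sum) (rule calculus_shift_funpow[OF h(1)])
      have rep_q: "(cmod (\<Sum>n<N. c n * (circle_char (int n) z * h z)))\<^sup>2 = q z * (cmod (h z))\<^sup>2" for z
        by (simp add: q_def norm_mult power_mult_distrib flip: sum_distrib_right mult.assoc)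
      have "(\<Sum>n<N. c n * (T ^^ n) \<phi> k) = complex_of_real S"
        by (simp add: S_def c_def complex_norm_square mult.commute del: of_real_power)
      then have "S\<^sup>2 = (\<Sum>x\<in>{k}. (cmod (\<Sum>n<N. c n * (T ^^ n) \<phi> x))\<^sup>2)"
        by simp
      also have "\<dots> \<le> (\<integral>z. q z * (cmod (h z))\<^sup>2 \<partial>\<mu>)"
        using calculus_sum_square_le[OF rep, of "{k}"] by (simp only: rep_q finite.intros)
      \<comment> \<open>Split \<open>h\<close> into the indicator of \<open>A\<close> and an error.
        The density bound controls the first part; the second is small by the choice of
        \<open>d\<close>.\<close>
      also have "\<dots> \<le> (\<integral>z. 2 * ((real N)\<^sup>2 * K) * (cmod (h z - indicator A z))\<^sup>2
          + 2 * (indicator A z * q z) \<partial>\<mu>)"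
      proof (rule integral_mono)
        show "integrable \<mu> (\<lambda>z. q z * (cmod (h z))\<^sup>2)"
          using calculus_integrable_square[OF rep] by (simp only: rep_q)
        have "integrable \<mu> (\<lambda>z. indicator A z * q z)"
          using q0 q_le K by (intro integrable_bounded[of _ "(real N)\<^sup>2 * K"]) (auto simp: indicator_def)
        then show "integrable \<mu> (\<lambda>z. 2 * ((real N)\<^sup>2 * K) * (cmod (h z - indicator A z))\<^sup>2
            + 2 * (indicator A z * q z))"
          using int_sq by simp
        fix z
        have "q z * (cmod (h z))\<^sup>2 \<le> q z * (2 * (cmod (h z - indicator A z))\<^sup>2 + 2 * indicator A z)"
          using cmod_add_square_le[of "h z - indicator A z" "indicator A z"] q0[of z]
          by (intro mult_left_mono) (auto simp: indicator_def)
        moreover have "q z * (cmod (h z - indicator A z))\<^sup>2 \<le> ((real N)\<^sup>2 * K) * (cmod (h z - indicator A z))\<^sup>2"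
          using q_le by (intro mult_right_mono) auto
        ultimately show "q z * (cmod (h z))\<^sup>2 \<le> 2 * ((real N)\<^sup>2 * K) * (cmod (h z - indicator A z))\<^sup>2
            + 2 * (indicator A z * q z)"
          by (simp add: algebra_simps)
      qed
      also have "\<dots> = 2 * ((real N)\<^sup>2 * K) * (\<integral>z. (cmod (h z - indicator A z))\<^sup>2 \<partial>\<mu>)
          + 2 * (\<integral>z. indicator A z * q z \<partial>\<mu>)"
      proof -
        have "integrable \<mu> (\<lambda>z. indicator A z * q z)"
          using q0 q_le K by (intro integrable_bounded[of _ "(real N)\<^sup>2 * K"]) (auto simp: indicator_def)
        then show ?thesis using int_sq by simp
      qed
      also have "\<dots> \<le> 1 + 2 * (real M * (2 * pi * S))"
      proof (rule add_mono)
        have "2 * ((real N)\<^sup>2 * K) * (\<integral>z. (cmod (h z - indicator A z))\<^sup>2 \<partial>\<mu>) \<le> 2 * ((real N)\<^sup>2 * K) * d"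
          using h(2) K by (intro mult_left_mono) auto
        then show "2 * ((real N)\<^sup>2 * K) * (\<integral>z. (cmod (h z - indicator A z))\<^sup>2 \<partial>\<mu>) \<le> 1"
          using dN by linarith
        have "(\<integral>z. q z \<partial>circle_lebesgue) = 2 * pi * S"
          by (simp add: q_def parseval_trig_poly S_def)
        moreover have "(\<integral>z. indicator A z * q z \<partial>\<mu>) \<le> real M * (\<integral>z. q z \<partial>circle_lebesgue)"
          unfolding A_def using f q q0 q_le by (rule density_sublevel_integral_le)
        ultimately show "2 * (\<integral>z. indicator A z * q z \<partial>\<mu>) \<le> 2 * (real M * (2 * pi * S))"
          by (simp add: mult_ac)
      qed
      \<comment> \<open>By Parseval \<open>S\<close> enters only linearly on the right but squared
        on the left. If \<open>S\<close> exceeded \<open>B\<close>, then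
        \<open>S\<^sup>2 > B * S > 1 + (B - 1) * S\<close>, because \<open>S > 1\<close>.\<close>
      finally have S2: "S\<^sup>2 \<le> 1 + (B - 1) * S" by (simp add: B_def mult_ac)
      have "S \<le> B"
      proof (rule ccontr)
        assume "\<not> S \<le> B"
        then have "1 < S" "B * S < S * S" using B by (auto intro: mult_strict_right_mono)
        with S2 show False by (simp add: power2_eq_square algebra_simps)
      qed
      then show ?thesis by (simp add: S_def c_def)
    qed
    with close h(1) show "\<exists>\<phi> h. calculus \<phi> h \<and>
      (\<forall>F. finite F \<longrightarrow> (\<Sum>x\<in>F. (cmod (\<phi> x - v 0 x))\<^sup>2) \<le> e) \<and>
      (\<forall>k. (\<Sum>n<N. (cmod ((T ^^ n) \<phi> k))\<^sup>2) \<le> B)"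
      by blast
  qed
qed

end

section \<open>Absence of absolutely continuous vectors\<close>

definition walk_orbit :: "(int \<Rightarrow> complex^2^2) \<Rightarrow> (int \<Rightarrow> complex) \<Rightarrow> int \<Rightarrow> (int \<Rightarrow> complex)" where
  "walk_orbit S \<psi> n = (if 0 \<le> n then (walk S ^^ nat n) \<psi> else (walk_inverse S ^^ nat (- n)) \<psi>)"

lemma walk_orbit_step:
  assumes "unitary_blocks S"
  shows "walk S (walk_orbit S \<psi> n) = walk_orbit S \<psi> (n + 1)"
proof (cases "0 \<le> n")
  case True
  then have "nat (n + 1) = Suc (nat n)" by simp
  then show ?thesis using True by (simp add: walk_orbit_def)
next
  case False
  then have "nat (- n) = Suc (nat (- (n + 1)))" by simp
  then have "walk S (walk_orbit S \<psi> n) = (walk_inverse S ^^ nat (- (n + 1))) \<psi>"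
    using False by (simp add: walk_orbit_def walk_walk_inverse[OF assms])
  then show ?thesis using False by (cases "n = - 1") (auto simp: walk_orbit_def)
qed

lemma walk_orbit_ell2:
  assumes "unitary_blocks S" "\<psi> \<in> ell2 UNIV"
  shows "walk_orbit S \<psi> n \<in> ell2 UNIV"
proof -
  have "(walk S ^^ k) \<psi> \<in> ell2 UNIV" "(walk_inverse S ^^ k) \<psi> \<in> ell2 UNIV" for k
    using assms by (induction k) (auto intro: walk_ell2 walk_inverse_ell2)
  then show ?thesis by (simp add: walk_orbit_def)
qed

text \<open>The walk is isometric and advances both times by one; the downward induction reads the
  same equality backwards. All inner products along the orbit thus reduce to those with the initial
  vector.\<close>

lemma walk_orbit_inner_shift:
  assumes "unitary_blocks S" "\<psi> \<in> ell2 UNIV"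
  shows "ell2_inner (walk_orbit S \<psi> (m + j)) (walk_orbit S \<psi> (n + j))
    = ell2_inner (walk_orbit S \<psi> m) (walk_orbit S \<psi> n)"
proof (induction j rule: int_induct[where k = 0])
  case (step1 j)
  then show ?case
    using walk_inner[OF assms(1) walk_orbit_ell2[OF assms] walk_orbit_ell2[OF assms], of "m + j" "n + j"]
    by (simp add: walk_orbit_step[OF assms(1)] add.assoc)
next
  case (step2 j)
  then show ?case
    using walk_inner[OF assms(1) walk_orbit_ell2[OF assms] walk_orbit_ell2[OF assms], of "m + (j - 1)" "n + (j - 1)"]
    by (simp add: walk_orbit_step[OF assms(1)] add.assoc)
qed simp

text \<open>The spectral measure prescribes the moments with \<open>m \<le> n\<close> after a time
  shift; the others follow by conjugation.\<close>

lemma unitary_orbit_walk: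
  assumes S: "unitary_blocks S" and psi: "\<psi> \<in> ell2 UNIV"
    and mu: "is_spectral_measure (walk S) \<psi> \<mu>"
  shows "unitary_orbit (walk S) (walk_orbit S \<psi>) \<mu>"
proof (rule unitary_orbit.intro)
  show fin: "finite_measure \<mu>" and sets: "sets \<mu> = sets borel"
    using mu by (auto simp: is_spectral_measure_def)
  have "emeasure \<mu> (- sphere 0 1) = 0" using mu by (simp add: is_spectral_measure_def)
  moreover have "- sphere (0::complex) 1 \<in> sets \<mu>" using sets by simp
  ultimately show sphere: "AE z in \<mu>. z \<in> sphere 0 1"
    by (intro AE_I[of _ _ "- sphere 0 1"]) auto
  fix m n
  have nonneg: "ell2_inner (walk_orbit S \<psi> m) (walk_orbit S \<psi> n) = (\<integral>z. circle_char (n - m) z \<partial>\<mu>)"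
    if "m \<le> n" for m n
  proof -
    define k where "k = nat (n - m)"
    have k: "n - m = int k" using that by (simp add: k_def)
    have "ell2_inner (walk_orbit S \<psi> m) (walk_orbit S \<psi> n)
        = ell2_inner (walk_orbit S \<psi> 0) (walk_orbit S \<psi> (n - m))"
      using walk_orbit_inner_shift[OF S psi, of 0 m "n - m"] by simp
    also have "\<dots> = (\<integral>z. z ^ k \<partial>\<mu>)"
      using mu by (simp add: k walk_orbit_def is_spectral_measure_def)
    also have "\<dots> = (\<integral>z. circle_char (n - m) z \<partial>\<mu>)"
    proof (rule integral_cong_AE)
      show "AE z in \<mu>. z ^ k = circle_char (n - m) z"
        using sphere by eventually_elim (simp add: k circle_char_on_sphere)
    qed (auto simp: measurable_cong_sets[OF sets refl])
    finally show ?thesis .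
  qed
  show "ell2_inner (walk_orbit S \<psi> m) (walk_orbit S \<psi> n) = (\<integral>z. circle_char (n - m) z \<partial>\<mu>)"
  proof (cases "m \<le> n")
    case False
    then have "ell2_inner (walk_orbit S \<psi> m) (walk_orbit S \<psi> n) = cnj (\<integral>z. circle_char (m - n) z \<partial>\<mu>)"
      by (subst ell2_inner_commute) (simp add: nonneg)
    then show ?thesis
      using Bochner_Integration.integral_cnj[of \<mu> "circle_char (m - n)"] by (simp add: cnj_circle_char)
  qed (rule nonneg)
qed (auto simp: walk_lincomb walk_orbit_step[OF S] walk_orbit_ell2[OF S psi])

section \<open>Mass balance over many time steps\<close>

text \<open>The losses of the single steps are added up. The weights 1, 3, 3, 1 give
  \<open>8 * B\<close> at each end, hence \<open>16 * B\<close> for both, and the factor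
  \<open>2 * d\<close> gives \<open>32 * d * B\<close>.\<close>

lemma walk_mass_loss_iterate:
  assumes S: "unitary_blocks S" and ab: "a \<le> b" and "n \<le> N"
    and d: "cmod (S a $ 1 $ 2) \<le> d" "cmod (S b $ 1 $ 2) \<le> d"
    and B: "\<And>k. (\<Sum>n<N. (cmod ((walk S ^^ n) \<phi> k))\<^sup>2) \<le> B"
  shows "(\<Sum>j\<in>{a<..b}. (cmod (\<phi> j))\<^sup>2) \<le> (\<Sum>j\<in>{a<..b}. (cmod ((walk S ^^ n) \<phi> j))\<^sup>2) + 32 * d * B"
proof -
  define m where "m i k = (cmod ((walk S ^^ i) \<phi> k))\<^sup>2" for i k
  define L where "L i k = m i (k - 1) + 3 * m i k + 3 * m i (k + 1) + m i (k + 2)" for i k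
  have m0: "0 \<le> m i k" for i k by (simp add: m_def)
  then have L0: "0 \<le> L i k" for i k by (simp add: L_def)
  have d0: "0 \<le> d" using d(1) norm_ge_zero order_trans by blast
  have step: "(\<Sum>j\<in>{a<..b}. m i j) \<le> (\<Sum>j\<in>{a<..b}. m (Suc i) j) + 2 * d * (L i a + L i b)" for i
  proof -
    have "2 * cmod (S k $ 1 $ 2) * L i k \<le> 2 * d * L i k" if "k = a \<or> k = b" for k
      using d that L0 by (intro mult_right_mono) auto
    from this[of a] this[of b] walk_mass_loss[OF S ab, of "(walk S ^^ i) \<phi>"]
    show ?thesis by (simp add: m_def L_def distrib_left)
  qed
  have "(\<Sum>j\<in>{a<..b}. m 0 j) \<le> (\<Sum>j\<in>{a<..b}. m n j) + 2 * d * (\<Sum>i<n. L i a + L i b)"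
  proof (induction n)
    case (Suc n)
    then show ?case using step[of n] by (simp add: distrib_left)
  qed simp
  also have "2 * d * (\<Sum>i<n. L i a + L i b) \<le> 2 * d * (16 * B)"
  proof (rule mult_left_mono)
    have "(\<Sum>i<n. L i k) \<le> 8 * B" for k
    proof -
      have "(\<Sum>i<n. L i k) \<le> (\<Sum>i<N. L i k)"
        using \<open>n \<le> N\<close> L0 by (intro sum_mono2) auto
      also have "\<dots> = (\<Sum>i<N. m i (k - 1)) + 3 * (\<Sum>i<N. m i k) + 3 * (\<Sum>i<N. m i (k + 1)) + (\<Sum>i<N. m i (k + 2))"
        by (simp add: L_def sum.distrib sum_distrib_left)
      also have "\<dots> \<le> 8 * B"
        using B[of "k - 1"] B[of k] B[of "k + 1"] B[of "k + 2"] unfolding m_def by linarith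
      finally show ?thesis .
    qed
    from this[of a] this[of b] show "(\<Sum>i<n. L i a + L i b) \<le> 16 * B" by (simp add: sum.distrib)
  qed (use d0 in simp)
  finally show ?thesis by (simp add: m_def)
qed

text \<open>The order of choices is decisive: \<open>B\<close> depends on \<open>e\<close> only,
  then come \<open>d\<close>, the ends \<open>a\<close> and \<open>b\<close>, the number
  \<open>N\<close> of steps, and last the truncated vector \<open>\<phi>\<close>.\<close>

lemma walk_absolutely_continuous_zero:
  assumes S: "unitary_blocks S"
    and right: "\<And>e n. 0 < e \<Longrightarrow> \<exists>b\<ge>n. cmod (S b $ 1 $ 2) < e"
    and left: "\<And>e n. 0 < e \<Longrightarrow> \<exists>a\<le>n. cmod (S a $ 1 $ 2) < e"
    and psi: "\<psi> \<in> ell2 UNIV" and mu: "is_spectral_measure (walk S) \<psi> \<mu>"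
    and ac: "absolutely_continuous circle_lebesgue \<mu>"
  shows "\<psi> k = 0"
proof -
  interpret unitary_orbit "walk S" "walk_orbit S \<psi>" \<mu>
    by (rule unitary_orbit_walk[OF S psi mu])
  have v0: "walk_orbit S \<psi> 0 = \<psi>" by (simp add: walk_orbit_def)
  have small: "(cmod (\<psi> k))\<^sup>2 \<le> 6 * e" if "0 < e" for e
  proof -
    obtain B where B: "\<And>N. \<exists>\<phi> h. calculus \<phi> h \<and>
      (\<forall>F. finite F \<longrightarrow> (\<Sum>x\<in>F. (cmod (\<phi> x - \<psi> x))\<^sup>2) \<le> e) \<and>
      (\<forall>k. (\<Sum>n<N. (cmod ((walk S ^^ n) \<phi> k))\<^sup>2) \<le> B)"
      using absolutely_continuous_truncation[OF ac \<open>0 < e\<close>] unfolding v0 by blast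
    have B0: "0 \<le> B" using B[of 0] by auto
    \<comment> \<open>Makes the total loss \<open>32 * d * B\<close> at most \<open>e\<close>; the
      summand 1 covers \<open>B = 0\<close>.\<close>
    define d where "d = e / (32 * B + 1)"
    have d: "0 < d" "32 * d * B \<le> e" using B0 \<open>0 < e\<close> by (auto simp: d_def field_simps)
    obtain a where a: "a \<le> k - 1" "cmod (S a $ 1 $ 2) < d" using left[OF d(1)] by blast
    obtain b where b: "k \<le> b" "cmod (S b $ 1 $ 2) < d" using right[OF d(1)] by blast
    \<comment> \<open>With so many steps the time average of the mass in the interval, at most
      \<open>(b - a) * B / N\<close>, is below \<open>e\<close>.\<close>
    obtain N :: nat where "real_of_int (b - a) * B / e < real N" using reals_Archimedean2 by blast
    then have N: "real_of_int (b - a) * B < e * real N" using \<open>0 < e\<close> by (simp add: field_simps)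
    have "0 \<le> real_of_int (b - a) * B" using a b B0 by simp
    with N have N0: "0 < real N" using \<open>0 < e\<close> by (metis le_less_trans zero_less_mult_pos)
    obtain \<phi> where \<phi>: "\<And>F. finite F \<Longrightarrow> (\<Sum>x\<in>F. (cmod (\<phi> x - \<psi> x))\<^sup>2) \<le> e"
      "\<And>k. (\<Sum>n<N. (cmod ((walk S ^^ n) \<phi> k))\<^sup>2) \<le> B"
      using B[of N] by blast
    define m where "m n = (\<Sum>j\<in>{a<..b}. (cmod ((walk S ^^ n) \<phi> j))\<^sup>2)" for n
    have "m 0 \<le> m n + e" if "n < N" for n
      using walk_mass_loss_iterate[OF S _ _ _ _ \<phi>(2), of a b n d] a b d(2) that by (simp add: m_def)
    \<comment> \<open>Averaging over time replaces a statement about any single late time;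
      exchanging the sums then allows the bound \<open>B\<close> at each site.\<close>
    then have "(\<Sum>n<N. m 0) \<le> (\<Sum>n<N. m n + e)" by (intro sum_mono) auto
    also have "\<dots> = (\<Sum>j\<in>{a<..b}. \<Sum>n<N. (cmod ((walk S ^^ n) \<phi> j))\<^sup>2) + real N * e"
      unfolding m_def by (simp add: sum.distrib sum.swap[of _ "{..<N}"])
    also have "\<dots> \<le> (\<Sum>j\<in>{a<..b}. B) + real N * e"
      using \<phi>(2) by (intro add_right_mono sum_mono)
    also have "\<dots> = real_of_int (b - a) * B + real N * e"
      using a b by simp
    also have "\<dots> \<le> real N * (2 * e)" using N by (simp add: mult.commute)
    finally have m0: "m 0 \<le> 2 * e" using N0 by simp
    have "(cmod (\<phi> k))\<^sup>2 \<le> m 0"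
      unfolding m_def using a b by (auto intro!: member_le_sum)
    moreover have "(cmod (\<psi> k - \<phi> k))\<^sup>2 \<le> e" using \<phi>(1)[of "{k}"] by (simp add: norm_minus_commute)
    \<comment> \<open>The truncated vector contributes \<open>2 * e\<close> and the truncation
      \<open>e\<close>; doubling their sum gives \<open>6 * e\<close>.\<close>
    ultimately show ?thesis
      using cmod_add_square_le[of "\<phi> k" "\<psi> k - \<phi> k"] m0 by simp
  qed
  have "(cmod (\<psi> k))\<^sup>2 \<le> 0"
  proof (rule field_le_epsilon)
    fix e :: real
    assume "0 < e"
    with small[of "e / 6"] show "(cmod (\<psi> k))\<^sup>2 \<le> 0 + e" by simp
  qed
  then show ?thesis by simp
qed

section \<open>Application to the two operators\<close>

text \<open>The coefficients may be negative. A zero lower limit eventually excludes values at or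
  below \<open>- e\<close>, so if the absolute values stayed at least \<open>e\<close>, the lower
  limit would be at least \<open>e\<close>.\<close>

lemma frequently_abs_less_if_Liminf_eq_0:
  fixes t :: "'a \<Rightarrow> real"
  assumes "Liminf F (\<lambda>k. ereal (t k)) = 0" "0 < e"
  shows "\<exists>\<^sub>F k in F. \<bar>t k\<bar> < e"
proof (rule ccontr)
  assume "\<not> ?thesis"
  then have "eventually (\<lambda>k. \<not> \<bar>t k\<bar> < e) F" by (simp add: frequently_def)
  moreover have "ereal (- e) < Liminf F (\<lambda>k. ereal (t k))" using assms by simp
  from less_LiminfD[OF this] have "eventually (\<lambda>k. - e < t k) F" by simp
  ultimately have "eventually (\<lambda>k. ereal e \<le> ereal (t k)) F"
    by eventually_elim auto
  then have "ereal e \<le> Liminf F (\<lambda>k. ereal (t k))" by (rule Liminf_bounded)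
  with assms show False by simp
qed

lemma cmod_scattering_matrix_offdiag: "cmod (scattering_matrix \<theta> \<alpha> \<gamma> r t k $ 1 $ 2) = \<bar>t k\<bar>"
  by (simp add: scattering_matrix_def norm_mult)

text \<open>On the zero space every shifted operator is a bijection with bounded inverse, so no
  point is spectral. The same holds formally on the empty set.\<close>

lemma ac_spectrum_empty:
  assumes "ac_subspace H T \<subseteq> {\<lambda>_. 0}" "T (\<lambda>_. 0) = (\<lambda>_. 0)"
  shows "ac_spectrum H T = {}"
proof -
  consider "ac_subspace H T = {}" | "ac_subspace H T = {\<lambda>_. 0}" using assms(1) by blast
  then show ?thesis
  proof cases
    case 2
    then show ?thesis
      using assms(2) by (auto simp: ac_spectrum_def spectrum_on_def bij_betw_def intro!: exI[of _ 1])
  qed (simp add: ac_spectrum_def spectrum_on_def bij_betw_def)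
qed

lemma ac_subspace_walk:
  assumes "\<And>k. (r k)\<^sup>2 + (t k)\<^sup>2 = 1"
    and "\<And>e n. 0 < e \<Longrightarrow> \<exists>b\<ge>n. \<bar>t b\<bar> < e" "\<And>e n. 0 < e \<Longrightarrow> \<exists>a\<le>n. \<bar>t a\<bar> < e"
  shows "ac_subspace (ell2 UNIV) (walk (scattering_matrix \<theta> \<alpha> \<gamma> r t)) \<subseteq> {\<lambda>_. 0}"
proof -
  have "\<psi> k = 0" if "\<psi> \<in> ell2 UNIV" "is_spectral_measure (walk (scattering_matrix \<theta> \<alpha> \<gamma> r t)) \<psi> \<mu>"
    "absolutely_continuous circle_lebesgue \<mu>" for \<psi> \<mu> k
    by (rule walk_absolutely_continuous_zero[OF unitary_scattering_matrix[OF assms(1)] _ _ that])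
       (use assms(2,3) in \<open>auto simp: cmod_scattering_matrix_offdiag\<close>)
  then show ?thesis by (auto simp: ac_subspace_def fun_eq_iff)
qed

text \<open>Replacing \<open>S\<^sub>0\<close> by \<open>exp (- i \<theta>\<^sub>0)\<close> times the identity decouples the two half-lines.\<close>

lemma U_plus_eq_walk:
  assumes "\<And>j. j < 1 \<Longrightarrow> \<psi> j = 0"
  shows "U_plus \<theta> \<alpha> \<gamma> r t \<psi> = walk (scattering_matrix \<theta> (\<alpha>(0 := 0)) \<gamma> (r(0 := 1)) (t(0 := 0))) \<psi>"
    (is "_ = walk ?S' \<psi>")
proof -
  let ?S = "scattering_matrix \<theta> \<alpha> \<gamma> r t"
  have S: "?S' j = ?S j" if "j \<noteq> 0" for j
    using that by (simp add: scattering_matrix_def)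
  \<comment> \<open>The changed block no longer couples sites 0 and 1 and acts at site 1 by the
    boundary phase of the half-line operator; setting \<open>\<alpha>\<close> to 0 there removes the
    extra phase.\<close>
  have S0: "?S' 0 $ 1 $ 2 = 0" "?S' 0 $ 2 $ 1 = 0" "?S' 0 $ 2 $ 2 = cis (- \<theta> 0)"
    by (simp_all add: scattering_matrix_def)
  have E: "U_even_plus (\<theta> 0) ?S \<psi> = layer even ?S' \<psi>"
  proof
    fix j :: int
    consider "j < 0" | "j = 0" | "j = 1" | "1 < j" by linarith
    then show "U_even_plus (\<theta> 0) ?S \<psi> j = layer even ?S' \<psi> j"
      using assms[of j] assms[of "j - 1"] assms[of "j + 1"] S[of j] S[of "j - 1"]
      by cases (auto simp: U_even_plus_def layer_def block_fst_def block_snd_def S0)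
  qed
  have "U_odd_plus ?S \<phi> j = layer odd ?S' \<phi> j" if \<phi>: "\<And>j. j < 1 \<Longrightarrow> \<phi> j = 0" for \<phi> j
  proof -
    consider "j < 0" | "j = 0" | "j = 1" | "1 < j" by linarith
    then show ?thesis
      using \<phi>[of j] \<phi>[of "j - 1"] \<phi>[of "j + 1"] S[of j] S[of "j - 1"]
      by cases (auto simp: U_odd_plus_def layer_def block_fst_def block_snd_def)
  qed
  moreover have "j < 1 \<Longrightarrow> U_even_plus (\<theta> 0) ?S \<psi> j = 0" for j
    by (simp add: U_even_plus_def)
  ultimately show ?thesis
    by (simp add: U_plus_def walk_def fun_eq_iff flip: E)
qed

lemma U_plus_support: "j < 1 \<Longrightarrow> U_plus \<theta> \<alpha> \<gamma> r t \<psi> j = 0"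
  by (simp add: U_plus_def U_odd_plus_def)

text \<open>A spectral measure is determined by the iterates of the vector, and these agree for both
  operators when the vector is supported on the half-line.\<close>

lemma ac_subspace_U_plus:
  "ac_subspace (ell2 {1..}) (U_plus \<theta> \<alpha> \<gamma> r t)
    \<subseteq> ac_subspace (ell2 UNIV) (walk (scattering_matrix \<theta> (\<alpha>(0 := 0)) \<gamma> (r(0 := 1)) (t(0 := 0))))"
    (is "_ \<subseteq> ac_subspace _ (walk ?S')")
proof
  fix \<psi>
  assume psi: "\<psi> \<in> ac_subspace (ell2 {1..}) (U_plus \<theta> \<alpha> \<gamma> r t)"
  then have ell2: "\<psi> \<in> ell2 {1..}" by (simp add: ac_subspace_def)
  have "(U_plus \<theta> \<alpha> \<gamma> r t ^^ n) \<psi> = (walk ?S' ^^ n) \<psi>" for n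
  proof (induction n)
    case (Suc n)
    have "(U_plus \<theta> \<alpha> \<gamma> r t ^^ n) \<psi> j = 0" if "j < 1" for j
      using that ell2 by (cases n) (auto simp: ell2_def U_plus_support)
    from U_plus_eq_walk[OF this, where \<theta> = \<theta> and \<alpha> = \<alpha> and \<gamma> = \<gamma> and r = r and t = t] show ?case
      by (simp only: funpow.simps o_apply Suc.IH)
  qed simp
  then show "\<psi> \<in> ac_subspace (ell2 UNIV) (walk ?S')"
    using psi by (auto simp: ac_subspace_def is_spectral_measure_def ell2_def)
qed

theorem theorem3p3:
  fixes \<theta> \<alpha> \<gamma> r t :: "int \<Rightarrow> real"
  assumes "\<And>k. (r k)\<^sup>2 + (t k)\<^sup>2 = 1"
    and "Liminf at_top (\<lambda>k. ereal (t k)) = 0"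
    and "Liminf at_bot (\<lambda>k. ereal (t k)) = 0"
  shows "ac_spectrum (ell2 UNIV) (U_full \<theta> \<alpha> \<gamma> r t) = {}
    \<and> ac_spectrum (ell2 {1..}) (U_plus \<theta> \<alpha> \<gamma> r t) = {}"
proof
  have right: "\<exists>b\<ge>n. \<bar>t b\<bar> < e" if "0 < e" for e n
    using frequently_abs_less_if_Liminf_eq_0[OF assms(2) that]
    by (auto simp: frequently_def eventually_at_top_linorder)
  have left: "\<exists>a\<le>n. \<bar>t a\<bar> < e" if "0 < e" for e n
    using frequently_abs_less_if_Liminf_eq_0[OF assms(3) that]
    by (auto simp: frequently_def eventually_at_bot_linorder)
  have U: "U_full \<theta> \<alpha> \<gamma> r t = walk (scattering_matrix \<theta> \<alpha> \<gamma> r t)"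
    by (simp add: U_full_def walk_def U_even_eq_layer U_odd_eq_layer)
  show "ac_spectrum (ell2 UNIV) (U_full \<theta> \<alpha> \<gamma> r t) = {}"
    unfolding U
    by (intro ac_spectrum_empty ac_subspace_walk assms(1) left right)
       (auto simp: walk_def layer_def block_fst_def block_snd_def fun_eq_iff)
  let ?r = "r(0 := 1)" and ?t = "t(0 := 0)"
  \<comment> \<open>Decoupling only decreases the moduli of the coefficients, so small values still
    occur arbitrarily far out in both directions.\<close>
  have t': "\<bar>?t k\<bar> \<le> \<bar>t k\<bar>" for k by simp
  have "ac_subspace (ell2 UNIV) (walk (scattering_matrix \<theta> (\<alpha>(0 := 0)) \<gamma> ?r ?t)) \<subseteq> {\<lambda>_. 0}"
  proof (rule ac_subspace_walk)
    show "(?r k)\<^sup>2 + (?t k)\<^sup>2 = 1" for k using assms(1) by simp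
    show "\<exists>b\<ge>n. \<bar>?t b\<bar> < e" "\<exists>a\<le>n. \<bar>?t a\<bar> < e" if "0 < e" for e n
      using right[OF that, of n] left[OF that, of n] t' le_less_trans by meson+
  qed
  then show "ac_spectrum (ell2 {1..}) (U_plus \<theta> \<alpha> \<gamma> r t) = {}"
    using ac_subspace_U_plus[of \<theta> \<alpha> \<gamma> r t]
    by (intro ac_spectrum_empty)
       (auto simp: U_plus_def U_odd_plus_def U_even_plus_def block_fst_def block_snd_def fun_eq_iff)
qed

end
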